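(* Let $\phi:[1,\infty)\to\mathbb{R}$ be any function with $\phi(t)\ge t$ for all $t\ge1$. Let $T$ be an operator such that, for some constant $c_1>0$, for every weight $w\in A_1$ on $\mathbb{R}^d$, $$\|T\|_{L^1(w)\to L^{1,\infty}(w)}\le c_1\,\phi([w]_{A_1}).$$ Then for every weight $w\in A_2$ on $\mathbb{R}^d$, $$\|T\|_{L^2(w)\to L^{2,\infty}(w)}\le c_1'\,\phi(c_2[w]_{A_2}),$$ where $c_2\ge 1$ depends only on $d$ and $c_1'$ depends only on $c_1$ and $d$.
   Context: A weight $w$ on $\mathbb{R}^d$ is an a.e. positive locally integrable function; $L^p(w)=L^p(\mathbb{R}^d,w\,dx)$, $w(E)=\int_E w\,dx$, $\langle w\rangle_I=|I|^{-1}\int_I w\,dx$. $w\in A_2$ means $[w]_{A_2}:=\sup_I\langle w\rangle_I\langle w^{-1}\rangle_I<\infty$ (supremum over all cubes). $w\in A_1$ means that there is $B<\infty$ with $\langle w\rangle_I\le B\inf_{x\in I}w(x)$ (essential infimum) for all cubes $I$; the smallest such $B$ is $[w]_{A_1}$. $\|f\|_{L^{p,\infty}(w)}=\sup_{t>0}t\,w(\{x:|f(x)|>t\})^{1/p}$. The operator $T$ is arbitrary (no kernel structure is assumed): it maps functions, including all those in $L^1(w)$ with $w\in A_1$ and in $L^2(w)$ with $w\in A_2$, to measurable functions; $\|T\|_{L^p(w)\to L^{p,\infty}(w)}$ is the best $C$ in $\|Tf\|_{L^{p,\infty}(w)}\le C\|f\|_{L^p(w)}$, and $T$ is positively homogeneous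 in the sense that $|T(\lambda f)|=\lambda|Tf|$ for $\lambda>0$. *)

theory Defs
  imports "HOL-Analysis.Analysis"
begin

text \<open>
  The ambient space is \<open>real ^ 'd\<close> with \<open>CARD('d) = d\<close>. Suprema, infima and averages are taken in
  \<^typ>\<open>ennreal\<close>, so that nothing has to be assumed finite beforehand. Functions are complex-valued
  functions, not a.e.-equivalence classes; an operator \<open>T\<close> on real-valued functions is covered via
  \<open>f \<mapsto> T (Re \<circ> f)\<close>, which satisfies the same norm bounds.
\<close>

definition cubes :: "(real ^ 'd) set set" where
  "cubes = {cbox a (a + (\<chi> i. l)) | a l. l > 0}"

definition average :: "(real ^ 'd \<Rightarrow> real) \<Rightarrow> (real ^ 'd) set \<Rightarrow> ennreal" where
  "average u I = (\<integral>\<^sup>+x\<in>I. ennreal (u x) \<partial>lebesgue) / emeasure lebesgue I"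

definition weight :: "(real ^ 'd \<Rightarrow> real) \<Rightarrow> bool" where
  "weight w \<longleftrightarrow> w \<in> borel_measurable lebesgue \<and> (AE x in lebesgue. w x > 0)
     \<and> (\<forall>K. compact K \<longrightarrow> set_integrable lebesgue K w)"

definition weighted :: "(real ^ 'd \<Rightarrow> real) \<Rightarrow> (real ^ 'd) measure" where
  "weighted w = density lebesgue (\<lambda>x. ennreal (w x))"

definition A2_const :: "(real ^ 'd \<Rightarrow> real) \<Rightarrow> ennreal" where
  "A2_const w = (SUP I\<in>cubes. average w I * average (\<lambda>x. inverse (w x)) I)"

definition A2 :: "(real ^ 'd \<Rightarrow> real) \<Rightarrow> bool" where
  "A2 w \<longleftrightarrow> weight w \<and> A2_const w < \<infinity>"

definition ess_inf_on :: "(real ^ 'd) set \<Rightarrow> (real ^ 'd \<Rightarrow> real) \<Rightarrow> ennreal" where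
  "ess_inf_on I w = Sup {z. AE x in lebesgue. x \<in> I \<longrightarrow> z \<le> ennreal (w x)}"

definition A1_bound :: "(real ^ 'd \<Rightarrow> real) \<Rightarrow> ennreal \<Rightarrow> bool" where
  "A1_bound w B \<longleftrightarrow> (\<forall>I\<in>cubes. average w I \<le> B * ess_inf_on I w)"

definition A1 :: "(real ^ 'd \<Rightarrow> real) \<Rightarrow> bool" where
  "A1 w \<longleftrightarrow> weight w \<and> (\<exists>B<\<infinity>. A1_bound w B)"

definition A1_const :: "(real ^ 'd \<Rightarrow> real) \<Rightarrow> ennreal" where
  "A1_const w = Inf {B. A1_bound w B}"

text \<open>Real powers with positive exponent on \<^typ>\<open>ennreal\<close>.\<close>

definition ennpowr :: "ennreal \<Rightarrow> real \<Rightarrow> ennreal" where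
  "ennpowr a r = (if a = \<infinity> then \<infinity> else ennreal (enn2real a powr r))"

definition Lp_norm :: "real \<Rightarrow> (real ^ 'd \<Rightarrow> real) \<Rightarrow> (real ^ 'd \<Rightarrow> complex) \<Rightarrow> ennreal" where
  "Lp_norm p w f = ennpowr (\<integral>\<^sup>+x. ennreal (norm (f x) powr p) \<partial>weighted w) (1 / p)"

definition Lp :: "real \<Rightarrow> (real ^ 'd \<Rightarrow> real) \<Rightarrow> (real ^ 'd \<Rightarrow> complex) set" where
  "Lp p w = {f. f \<in> borel_measurable lebesgue \<and> Lp_norm p w f < \<infinity>}"

definition weak_Lp_norm :: "real \<Rightarrow> (real ^ 'd \<Rightarrow> real) \<Rightarrow> (real ^ 'd \<Rightarrow> complex) \<Rightarrow> ennreal" where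
  "weak_Lp_norm p w f =
     (SUP t\<in>{0<..}. ennreal t * ennpowr (emeasure (weighted w) {x. norm (f x) > t}) (1 / p))"

text \<open>The best constant; it is \<open>\<infinity>\<close> if no finite constant works.\<close>

definition weak_opnorm ::
  "real \<Rightarrow> (real ^ 'd \<Rightarrow> real) \<Rightarrow> ((real ^ 'd \<Rightarrow> complex) \<Rightarrow> real ^ 'd \<Rightarrow> complex) \<Rightarrow> ennreal" where
  "weak_opnorm p w T = Inf {C. \<forall>f\<in>Lp p w. weak_Lp_norm p w (T f) \<le> C * Lp_norm p w f}"

text \<open>
  HOL functions are total, so \<open>T\<close> is constrained only on the functions on which it has to be defined;
  its values elsewhere are irrelevant.
\<close>

definition op_domain :: "(real ^ 'd \<Rightarrow> complex) set" where
  "op_domain = (\<Union>w\<in>{w. A1 w}. Lp 1 w) \<union> (\<Union>w\<in>{w. A2 w}. Lp 2 w)"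

definition admissible_operator ::
  "((real ^ 'd \<Rightarrow> complex) \<Rightarrow> real ^ 'd \<Rightarrow> complex) \<Rightarrow> bool" where
  "admissible_operator T \<longleftrightarrow>
     (\<forall>f\<in>op_domain. T f \<in> borel_measurable lebesgue) \<and>
     (\<forall>f\<in>op_domain. \<forall>c::real. c > 0 \<longrightarrow>
        (AE x in lebesgue. norm (T (\<lambda>y. of_real c * f y) x) = c * norm (T f x)))"

end

theory Submission
  imports Defs
begin

text \<open>
  Fix \<open>w\<close> in A2, a function \<open>f\<close>, a level \<open>t\<close> and a bounded piece \<open>E\<close> of \<open>{\<bar>T f\<bar> > t}\<close>. The weak
  (1,1) hypothesis can be used with any A1 weight \<open>u\<close> that dominates \<open>w\<close> on \<open>E\<close>:
  \<open>t w(E) \<le> t u({\<bar>T f\<bar> > t}) \<le> K \<integral> \<bar>f\<bar> u\<close>, and by Cauchy-Schwarz the last integral is at most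
  \<open>(\<integral> \<bar>f\<bar>\<^sup>2 w)^(1/2) (\<integral> u\<^sup>2 / w)^(1/2)\<close>. If moreover \<open>\<integral> u\<^sup>2 / w \<le> C w(E)\<close>, one factor \<open>w(E)^(1/2)\<close> cancels
  and the weak (2,2) bound remains. So everything rests on such a majorant \<open>u\<close> whose A1 constant is
  proportional to the A2 constant of \<open>w\<close>.

  The majorant comes from Rubio de Francia's iteration \<open>v = 1_E w + M v / (2 A)\<close>: its fixed point
  satisfies \<open>M v \<le> 2 A v\<close>, hence lies in A1, and its norm in \<open>L\<^sup>2(1/w)\<close> is controlled when \<open>A\<close> bounds
  the norm of \<open>M\<close> there (\<open>rubio_de_francia\<close>, \<open>A1_majorant\<close>). For a constant linear in the
  A2 constant one needs Buckley's sharp estimate for \<open>M\<close>. It is proved by Lerner's argument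
  (\<open>maxfn_weighted_L2\<close>): on a laminar family of sets the maximal function is dominated by a composition
  of two maximal functions, each taken with respect to a weight, and those are bounded on
  \<open>L\<^sup>2\<close> with a constant that does not see the weight, by Doob's inequality (\<open>maxfn_L2\<close>). To replace all
  cubes by laminar families, \<open>M\<close> is taken to be the maximum over finitely many shifted dyadic grids,
  such that every cube lies in a cell of comparable size of one of them (\<open>cube_subset_grid\<close>).

  Since \<open>\<phi>\<close> is not assumed to be monotone, an A1 constant of at most \<open>N = c\<^sub>2 [w]\<close> does not suffice: it has
  to be equal to \<open>N\<close>. This is arranged by multiplying \<open>v\<close> by \<open>1 + s 1_Q\<close> for a cube \<open>Q\<close> (\<open>A1_exact_constant\<close>).
  The A1 constant depends continuously on \<open>s\<close>, and it exceeds \<open>N\<close> at a value of \<open>s\<close> that does not depend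
  on the size of \<open>Q\<close> (\<open>spike_lower_bound\<close>); so \<open>Q\<close> can be chosen so small that the integral of \<open>\<bar>f\<bar> v\<close> at
  most doubles.
\<close>

section \<open>Doob's inequality for a laminar family\<close>

definition laminar :: "'a set set \<Rightarrow> bool" where
  "laminar D \<longleftrightarrow> (\<forall>P\<in>D. \<forall>Q\<in>D. P \<inter> Q = {} \<or> P \<subseteq> Q \<or> Q \<subseteq> P)"

definition mean :: "'a measure \<Rightarrow> ('a \<Rightarrow> ennreal) \<Rightarrow> 'a set \<Rightarrow> ennreal" where
  "mean M f Q = (\<integral>\<^sup>+x\<in>Q. f x \<partial>M) / emeasure M Q"

definition maxfn :: "'a measure \<Rightarrow> 'a set set \<Rightarrow> ('a \<Rightarrow> ennreal) \<Rightarrow> 'a \<Rightarrow> ennreal" where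
  "maxfn M D f x = (SUP Q\<in>D. mean M f Q * indicator Q x)"

lemma maxfn_measurable [measurable]:
  assumes "countable D" "D \<subseteq> sets M"
  shows "maxfn M D f \<in> borel_measurable M"
proof -
  have "(\<lambda>x. SUP Q\<in>D. mean M f Q * indicator Q x) \<in> borel_measurable M"
    using assms by (intro borel_measurable_SUP) auto
  then show ?thesis unfolding maxfn_def[abs_def] .
qed

text \<open>
  The degenerate cases are covered by the conventions: the quotient is 0 for \<open>b = \<infinity>\<close>, and the product is 0
  for \<open>b = 0\<close>.
\<close>

lemma divide_less_imp_mult_le:
  fixes a b c :: ennreal
  assumes "c < a / b"
  shows "c * b \<le> a"
proof -
  have "c * b \<le> a / b * b" using assms by (intro mult_right_mono) auto
  also have "\<dots> \<le> a"
    by (cases "b = 0 \<or> b = top") (auto simp: ennreal_divide_times less_top)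
  finally show ?thesis .
qed

lemma less_maxfn_iff: "c < maxfn M D f x \<longleftrightarrow> (\<exists>Q\<in>D. x \<in> Q \<and> c < mean M f Q)"
  by (auto simp: maxfn_def less_SUP_iff indicator_def)

text \<open>
  The superlevel set is the union of the sets whose mean exceeds \<open>c\<close>. In a finite laminar family the maximal
  ones among them are disjoint and have the same union, so the estimates on each of them add up.
\<close>

lemma maxfn_weak_type:
  assumes fin: "finite D" and lam: "laminar D" and sub: "D \<subseteq> sets M"
    and f [measurable]: "f \<in> borel_measurable M"
  shows "c * emeasure M {x\<in>space M. c < maxfn M D f x}
           \<le> (\<integral>\<^sup>+x. f x * indicator {x\<in>space M. c < maxfn M D f x} x \<partial>M)"
proof -
  define B where "B = {Q\<in>D. c < mean M f Q}"
  \<comment> \<open>the maximal members of \<open>B\<close>\<close>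
  define X where "X = {Q\<in>B. \<forall>P\<in>B. Q \<subseteq> P \<longrightarrow> P = Q}"
  have finB: "finite B" and finX: "finite X" using fin by (auto simp: B_def X_def)
  have XD: "X \<subseteq> D" by (auto simp: X_def B_def)
  have "\<Union>X = \<Union>B"
  proof (intro equalityI subsetI)
    fix x assume "x \<in> \<Union>B"
    then obtain Q where Q: "Q \<in> B" "x \<in> Q" by auto
    obtain P where P: "P \<in> B" "Q \<subseteq> P" "\<And>R. R \<in> B \<Longrightarrow> P \<subseteq> R \<Longrightarrow> R = P"
      using finite_has_maximal2[OF finB Q(1)] by blast
    then show "x \<in> \<Union>X" using Q unfolding X_def by blast
  qed (auto simp: X_def)
  moreover have "{x\<in>space M. c < maxfn M D f x} = \<Union>B"
    using sub sets.sets_into_space unfolding less_maxfn_iff B_def by blast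
  ultimately have eq: "{x\<in>space M. c < maxfn M D f x} = \<Union>X" by simp
  have disj: "disjoint_family_on (\<lambda>Q. Q) X"
    unfolding disjoint_family_on_def
  proof (intro ballI impI)
    fix P Q assume PQ: "P \<in> X" "Q \<in> X" "P \<noteq> Q"
    then have "\<not> P \<subseteq> Q" "\<not> Q \<subseteq> P" by (auto simp: X_def)
    moreover have "P \<in> D" "Q \<in> D" using PQ XD by auto
    ultimately show "P \<inter> Q = {}" using lam unfolding laminar_def by blast
  qed
  have sets: "(\<lambda>Q. Q) ` X \<subseteq> sets M" using XD sub by auto
  have "c * emeasure M (\<Union>X) = (\<Sum>Q\<in>X. c * emeasure M Q)"
    using sum_emeasure[OF sets disj finX] by (simp flip: sum_distrib_left)
  also have "\<dots> \<le> (\<Sum>Q\<in>X. emeasure (density M f) Q)"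
  proof (rule sum_mono)
    fix Q assume "Q \<in> X"
    then have "c < mean M f Q" "Q \<in> sets M" using XD sub by (auto simp: X_def B_def)
    then show "c * emeasure M Q \<le> emeasure (density M f) Q"
      unfolding mean_def using divide_less_imp_mult_le by (auto simp: emeasure_density)
  qed
  also have "\<dots> = emeasure (density M f) (\<Union>X)"
    using sum_emeasure[of "\<lambda>Q. Q" X "density M f"] sets disj finX by simp
  also have "\<dots> = (\<integral>\<^sup>+x. f x * indicator (\<Union>X) x \<partial>M)"
    using sets finX by (intro emeasure_density) auto
  finally show ?thesis unfolding eq .
qed

lemma of_nat_le_imp_top:
  fixes c :: ennreal
  assumes "\<And>n::nat. of_nat n \<le> c"
  shows "c = \<infinity>"
proof -
  have "(SUP n. of_nat n :: ennreal) \<le> c" using assms by (intro SUP_least)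
  then show ?thesis by (simp add: ennreal_SUP_of_nat_eq_top top_unique)
qed

text \<open>
  This and the next lemma are the layer cake formulas for the first and second power; they stay valid at
  \<open>c = \<infinity>\<close>.
\<close>

lemma layer_length: "(\<integral>\<^sup>+t. indicator {t. 0 \<le> t \<and> ennreal t < c} t \<partial>lborel) = c"
proof (cases c)
  case (real r)
  have "{t. 0 \<le> t \<and> ennreal t < c} = {0..<r}" using real by (auto simp: ennreal_less_iff)
  then show ?thesis using real by simp
next
  case top
  have "{t. 0 \<le> t \<and> ennreal t < c} = {0..}" using top by auto
  moreover have "of_nat n \<le> emeasure lborel {0::real..}" for n
  proof -
    have "of_nat n = emeasure lborel {0..real n}" by (simp add: ennreal_of_nat_eq_real_of_nat)
    also have "\<dots> \<le> emeasure lborel {0::real..}" by (intro emeasure_mono) auto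
    finally show ?thesis .
  qed
  then have "emeasure lborel {0::real..} = \<infinity>" by (rule of_nat_le_imp_top)
  ultimately show ?thesis using top by simp
qed

lemma layer_square:
  "(\<integral>\<^sup>+t. ennreal (2 * t) * indicator {t. 0 \<le> t \<and> ennreal t < c} t \<partial>lborel) = c^2"
proof -
  have fin: "(\<integral>\<^sup>+t. ennreal (2 * t) * indicator {0..<r} t \<partial>lborel) = (ennreal r)^2" if "0 \<le> r" for r
  proof -
    have "(\<integral>\<^sup>+t. ennreal (2 * t) * indicator {0..<r} t \<partial>lborel)
       = (\<integral>\<^sup>+t. ennreal (2 * t) * indicator {0..r} t \<partial>lborel)"
      using AE_lborel_singleton[of r] by (intro nn_integral_cong_AE) (auto simp: indicator_def)
    also have "\<dots> = ennreal (r^2 - 0^2)"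
      using that by (intro nn_integral_FTC_Icc) (auto intro!: derivative_eq_intros)
    finally show ?thesis using that by (simp add: ennreal_power)
  qed
  show ?thesis
  proof (cases c)
    case (real r)
    have "{t. 0 \<le> t \<and> ennreal t < c} = {0..<r}" using real by (auto simp: ennreal_less_iff)
    then show ?thesis using real fin by simp
  next
    case top
    let ?I = "\<integral>\<^sup>+t. ennreal (2 * t) * indicator {t. 0 \<le> t \<and> ennreal t < c} t \<partial>lborel"
    have "of_nat n \<le> ?I" for n
    proof -
      have "of_nat n \<le> (ennreal (real n))^2" 
        by (cases "n = 0") (auto simp: ennreal_power ennreal_of_nat_eq_real_of_nat intro!: ennreal_leI self_le_power)
      also have "\<dots> = (\<integral>\<^sup>+t. ennreal (2 * t) * indicator {0..<real n} t \<partial>lborel)" by (simp add: fin)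
      also have "\<dots> \<le> ?I" using top by (intro nn_integral_mono) (auto simp: indicator_def)
      finally show ?thesis .
    qed
    then have "?I = \<infinity>" by (rule of_nat_le_imp_top)
    then show ?thesis using top by simp
  qed
qed


text \<open>
  Integrating the weak type inequality against \<open>2 t dt\<close> gives \<open>\<integral> g\<^sup>2 \<le> 2 \<integral> f g\<close> for the maximal function \<open>g\<close>.
  Finiteness of the family makes \<open>\<integral> g\<^sup>2\<close> finite, so that it may be absorbed after \<open>4 f g \<le> 4 f\<^sup>2 + g\<^sup>2\<close>.
\<close>

lemma maxfn_L2_finite:
  assumes "sigma_finite_measure M" and fin: "finite D" and lam: "laminar D" and sub: "D \<subseteq> sets M"
    and finite_measure: "\<And>Q. Q \<in> D \<Longrightarrow> emeasure M Q < \<infinity>"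
    and f [measurable]: "f \<in> borel_measurable M"
  shows "(\<integral>\<^sup>+x. (maxfn M D f x)^2 \<partial>M) \<le> 4 * (\<integral>\<^sup>+x. (f x)^2 \<partial>M)"
proof (cases "(\<integral>\<^sup>+x. (f x)^2 \<partial>M) < \<infinity>")
  case False
  then show ?thesis by (simp add: ennreal_mult_top less_top[symmetric])
next
  case True
  interpret M: sigma_finite_measure M by fact
  interpret P: pair_sigma_finite M "lborel :: real measure" ..
  define g where "g = maxfn M D f"
  have g [measurable]: "g \<in> borel_measurable M"
    unfolding g_def using fin sub by (intro maxfn_measurable countable_finite)
  define k :: "'a \<Rightarrow> real \<Rightarrow> ennreal" where "k x t = (if 0 \<le> t \<and> ennreal t < g x then 1 else 0)" for x t
  have k [measurable]: "case_prod k \<in> borel_measurable (M \<Otimes>\<^sub>M lborel)"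
    unfolding k_def by measurable
  have k_ind: "k x t = indicator {t. 0 \<le> t \<and> ennreal t < g x} t" for x t
    by (simp add: k_def)
  have k_length: "integral\<^sup>N lborel (k x) = g x" for x
  proof -
    have "k x = indicator {t. 0 \<le> t \<and> ennreal t < g x}" by (rule ext) (rule k_ind)
    then show ?thesis using layer_length by simp
  qed
  have mean_fin: "mean M f Q < \<infinity>" if "Q \<in> D" for Q
  proof -
    have Q [measurable]: "Q \<in> sets M" using that sub by auto
    have "(\<integral>\<^sup>+x. f x * indicator Q x \<partial>M)^2 \<le> (\<integral>\<^sup>+x. (f x)^2 \<partial>M) * (\<integral>\<^sup>+x. (indicator Q x)^2 \<partial>M)"
      by (intro Cauchy_Schwarz_nn_integral) auto
    also have "(\<integral>\<^sup>+x. (indicator Q x)^2 \<partial>M) = emeasure M Q"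
      by (simp add: power2_eq_square flip: indicator_inter_arith)
    also have "(\<integral>\<^sup>+x. (f x)^2 \<partial>M) * emeasure M Q < \<infinity>"
      using True finite_measure[OF that] by (simp add: ennreal_mult_less_top)
    finally have "(\<integral>\<^sup>+x. f x * indicator Q x \<partial>M) < \<infinity>"
      by (auto simp: power2_eq_square ennreal_mult_less_top)
    moreover have "(\<integral>\<^sup>+x. f x * indicator Q x \<partial>M) = 0" if "emeasure M Q = 0"
      using that Q by (intro nn_integral_null_set) auto
    ultimately show ?thesis unfolding mean_def
      by (auto simp: less_top[symmetric] ennreal_divide_eq_top_iff)
  qed
  have g_fin: "(\<integral>\<^sup>+x. (g x)^2 \<partial>M) < \<infinity>"
  proof -
    define K where "K = (\<Sum>Q\<in>D. mean M f Q)"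
    have "g x \<le> K * indicator (\<Union>D) x" for x
      unfolding g_def maxfn_def
    proof (rule SUP_least)
      fix Q assume Q: "Q \<in> D"
      then have "mean M f Q \<le> K" unfolding K_def using fin by (intro member_le_sum) auto
      then show "mean M f Q * indicator Q x \<le> K * indicator (\<Union>D) x"
        using Q by (auto simp: indicator_def)
    qed
    then have "(g x)^2 \<le> (K * indicator (\<Union>D) x)^2" for x
      by (intro power_mono) auto
    moreover have "(K * indicator (\<Union>D) x)^2 = K^2 * indicator (\<Union>D) x" for x
      by (auto simp: indicator_def)
    ultimately have "(g x)^2 \<le> K^2 * indicator (\<Union>D) x" for x by metis
    then have "(\<integral>\<^sup>+x. (g x)^2 \<partial>M) \<le> (\<integral>\<^sup>+x. K^2 * indicator (\<Union>D) x \<partial>M)"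
      by (intro nn_integral_mono)
    also have "\<dots> = K^2 * emeasure M (\<Union>D)"
      using fin sub by (intro nn_integral_cmult_indicator) auto
    also have "\<dots> < \<infinity>"
    proof -
      have "K < \<infinity>" unfolding K_def using mean_fin fin by (simp add: less_top)
      moreover have "emeasure M (\<Union>D) \<le> (\<Sum>Q\<in>D. emeasure M Q)"
        using emeasure_subadditive_finite[of D "\<lambda>Q. Q" M] fin sub by simp
      moreover have "\<dots> < \<infinity>" using fin finite_measure by (simp add: less_top)
      ultimately show ?thesis
        by (auto simp: ennreal_mult_less_top power2_eq_square)
    qed
    finally show ?thesis .
  qed
  have "(\<integral>\<^sup>+x. (g x)^2 \<partial>M) = (\<integral>\<^sup>+x. (\<integral>\<^sup>+t. ennreal (2 * t) * k x t \<partial>lborel) \<partial>M)"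
    unfolding k_ind layer_square ..
  also have "\<dots> = (\<integral>\<^sup>+t. (\<integral>\<^sup>+x. ennreal (2 * t) * k x t \<partial>M) \<partial>lborel)"
    by (rule P.Fubini'[symmetric]) measurable
  also have "\<dots> \<le> (\<integral>\<^sup>+t. (\<integral>\<^sup>+x. 2 * f x * k x t \<partial>M) \<partial>lborel)"
  proof (rule nn_integral_mono)
    fix t :: real
    show "(\<integral>\<^sup>+x. ennreal (2 * t) * k x t \<partial>M) \<le> (\<integral>\<^sup>+x. 2 * f x * k x t \<partial>M)"
    proof (cases "0 \<le> t")
      case True
      define S where "S = {x\<in>space M. ennreal t < g x}"
      have [measurable]: "S \<in> sets M" unfolding S_def by measurable
      have kS: "k x t = indicator S x" if "x \<in> space M" for x
        using that True by (simp add: k_def S_def)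
      have "(\<integral>\<^sup>+x. ennreal (2 * t) * k x t \<partial>M) = ennreal (2 * t) * emeasure M S"
        by (simp add: kS nn_integral_cmult_indicator cong: nn_integral_cong)
      also have "\<dots> = 2 * (ennreal t * emeasure M S)"
        using True by (simp add: ennreal_mult mult.assoc)
      also have "\<dots> \<le> 2 * (\<integral>\<^sup>+x. f x * indicator S x \<partial>M)"
        unfolding S_def g_def using fin lam sub f by (intro mult_left_mono maxfn_weak_type) auto
      also have "\<dots> = (\<integral>\<^sup>+x. 2 * f x * k x t \<partial>M)"
        by (simp add: kS nn_integral_cmult mult.assoc cong: nn_integral_cong)
      finally show ?thesis .
    qed (simp add: k_def)
  qed
  also have "\<dots> = (\<integral>\<^sup>+x. (\<integral>\<^sup>+t. 2 * f x * k x t \<partial>lborel) \<partial>M)"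
    by (rule P.Fubini') measurable
  also have "\<dots> = (\<integral>\<^sup>+x. 2 * f x * g x \<partial>M)"
    by (intro nn_integral_cong, subst nn_integral_cmult) (auto simp: k_length)
  finally have *: "(\<integral>\<^sup>+x. (g x)^2 \<partial>M) \<le> (\<integral>\<^sup>+x. 2 * f x * g x \<partial>M)" .
  have "2 * (\<integral>\<^sup>+x. (g x)^2 \<partial>M) \<le> 2 * (\<integral>\<^sup>+x. 2 * f x * g x \<partial>M)"
    using * by (intro mult_left_mono) auto
  also have "\<dots> = (\<integral>\<^sup>+x. 2 * (2 * f x) * g x \<partial>M)"
    by (subst nn_integral_cmult[symmetric]) (auto simp: mult.assoc)
  also have "\<dots> \<le> (\<integral>\<^sup>+x. (2 * f x)^2 + (g x)^2 \<partial>M)"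
    by (intro nn_integral_mono sum_of_squares_ge_ennreal)
  also have "\<dots> = 4 * (\<integral>\<^sup>+x. (f x)^2 \<partial>M) + (\<integral>\<^sup>+x. (g x)^2 \<partial>M)"
    by (simp add: nn_integral_add power_mult_distrib nn_integral_cmult)
  finally have "(\<integral>\<^sup>+x. (g x)^2 \<partial>M) + (\<integral>\<^sup>+x. (g x)^2 \<partial>M)
      \<le> (\<integral>\<^sup>+x. (g x)^2 \<partial>M) + 4 * (\<integral>\<^sup>+x. (f x)^2 \<partial>M)"
    by (simp add: mult_2 add.commute)
  then show ?thesis using g_fin by (auto simp: g_def ennreal_add_left_cancel_le)
qed

lemma SUP_power2_ennreal:
  fixes f :: "nat \<Rightarrow> ennreal"
  assumes "incseq f"
  shows "(SUP n. f n)^2 = (SUP n. (f n)^2)"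
proof (rule antisym)
  have "(SUP n. f n)^2 = (SUP j. SUP i. f i * f j)"
    by (simp add: power2_eq_square SUP_mult_right_ennreal SUP_mult_left_ennreal)
  also have "\<dots> \<le> (SUP n. (f n)^2)"
  proof (intro SUP_least)
    fix i j
    have "f i * f j \<le> (f (max i j))^2"
      unfolding power2_eq_square using assms by (intro mult_mono) (auto simp: incseq_def)
    then show "f i * f j \<le> (SUP n. (f n)^2)" by (rule SUP_upper2[rotated]) simp
  qed
  finally show "(SUP n. f n)^2 \<le> (SUP n. (f n)^2)" .
qed (auto intro!: SUP_least power_mono SUP_upper)

text \<open>
  The constant of the finite case does not depend on the family, so monotone convergence along an
  exhaustion extends it to countable families.
\<close>

lemma maxfn_L2:
  assumes "sigma_finite_measure M" and count: "countable D" and lam: "laminar D" and sub: "D \<subseteq> sets M"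
    and finite_measure: "\<And>Q. Q \<in> D \<Longrightarrow> emeasure M Q < \<infinity>"
    and f [measurable]: "f \<in> borel_measurable M"
  shows "(\<integral>\<^sup>+x. (maxfn M D f x)^2 \<partial>M) \<le> 4 * (\<integral>\<^sup>+x. (f x)^2 \<partial>M)"
proof (cases "D = {}")
  case False
  define E where "E n = from_nat_into D ` {..n}" for n
  have ED: "E n \<subseteq> D" for n using from_nat_into[OF False] by (auto simp: E_def)
  have inc: "incseq E" by (auto simp: incseq_def E_def)
  have UE: "(\<Union>n. E n) = D"
  proof -
    have "(\<Union>n. E n) = range (from_nat_into D)" unfolding E_def by blast
    then show ?thesis using range_from_nat_into[OF False count] by simp
  qed
  have eq: "maxfn M D f x = (SUP n. maxfn M (E n) f x)" for x
    unfolding maxfn_def by (subst UE[symmetric]) (rule SUP_UNION)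
  have mono: "incseq (\<lambda>n. maxfn M (E n) f x)" for x
    using inc unfolding incseq_def maxfn_def by (auto intro!: SUP_subset_mono)
  have eq2: "(maxfn M D f x)^2 = (SUP n. (maxfn M (E n) f x)^2)" for x
    unfolding eq by (rule SUP_power2_ennreal[OF mono])
  have [measurable]: "maxfn M (E n) f \<in> borel_measurable M" for n
    using ED sub by (intro maxfn_measurable) (auto simp: E_def)
  have "(\<integral>\<^sup>+x. (maxfn M D f x)^2 \<partial>M) = (SUP n. \<integral>\<^sup>+x. (maxfn M (E n) f x)^2 \<partial>M)"
    unfolding eq2 using mono
    by (intro nn_integral_monotone_convergence_SUP) (auto simp: incseq_def le_fun_def intro!: power_mono)
  also have "\<dots> \<le> 4 * (\<integral>\<^sup>+x. (f x)^2 \<partial>M)"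
  proof (intro SUP_least maxfn_L2_finite)
    show "laminar (E n)" for n using lam ED[of n] unfolding laminar_def by blast
  qed (use assms ED sub in \<open>auto simp: E_def\<close>)
  finally show ?thesis .
qed (simp add: maxfn_def bot_ennreal)

section \<open>The sharp weighted bound for a laminar maximal function\<close>

lemma maxfn_measurable_cong: "\<lbrakk>countable D; D \<subseteq> sets M; sets N = sets M\<rbrakk> \<Longrightarrow> maxfn N D f \<in> borel_measurable M"
  using maxfn_measurable[of D N f] by (simp cong: measurable_cong_sets)

lemma emeasure_density_pos:
  assumes [measurable]: "w \<in> borel_measurable N" "Q \<in> sets N"
    and "AE x in N. 0 < w x" "0 < emeasure N Q"
  shows "0 < (\<integral>\<^sup>+x\<in>Q. w x \<partial>N)"
proof (rule ccontr)
  assume "\<not> 0 < (\<integral>\<^sup>+x\<in>Q. w x \<partial>N)"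
  then have "(\<integral>\<^sup>+x\<in>Q. w x \<partial>N) = 0" by simp
  then have "AE x in N. w x * indicator Q x = 0" by (subst (asm) nn_integral_0_iff_AE) auto
  with assms(3) have "AE x in N. x \<notin> Q" by eventually_elim (auto simp: indicator_def)
  then have "emeasure N Q = 0" using AE_iff_null_sets[of Q N] by auto
  with assms(4) show False by simp
qed

text \<open>
  The combination of measures in which the A2 condition enters Lerner's argument: \<open>p\<close>, \<open>q\<close> and \<open>n\<close> stand for
  the measures \<open>w(Q)\<close>, \<open>s(Q)\<close> and \<open>\<bar>Q\<bar>\<close> of one set, and \<open>a\<close> for the integral of a function over it.
\<close>

lemma A2_average_algebra:
  fixes a C p q n :: ennreal
  assumes "0 < p" "p < \<infinity>" "0 < q" "q < \<infinity>" "0 < n" "n < \<infinity>" "p * q \<le> C * n^2"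
  shows "a / n \<le> C * ((a / q * n) / p)"
proof -
  obtain p' where p: "p = ennreal p'" "0 < p'" using assms by (cases p) auto
  obtain q' where q: "q = ennreal q'" "0 < q'" using assms by (cases q) auto
  obtain n' where n: "n = ennreal n'" "0 < n'" using assms by (cases n) auto
  have "a / n = a * ennreal (inverse n')"
    using n by (simp add: divide_ennreal_def inverse_ennreal)
  also have "inverse n' = inverse (n' * p' * q') * (p' * q')" using p q n by (simp add: field_simps)
  also have "a * ennreal \<dots> = a * ennreal (inverse (n' * p' * q')) * (p * q)"
    using p q n by (simp add: ennreal_mult mult.assoc)
  also have "\<dots> \<le> a * ennreal (inverse (n' * p' * q')) * (C * n^2)"
    using assms by (intro mult_left_mono) auto
  also have "\<dots> = C * (a * (ennreal (inverse (n' * p' * q') * n'^2)))"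
    using p q n by (simp add: ennreal_mult ennreal_power mult_ac)
  also have "inverse (n' * p' * q') * n'^2 = inverse q' * n' * inverse p'"
    using p q n by (simp add: field_simps power2_eq_square)
  also have "C * (a * ennreal \<dots>) = C * ((a / q * n) / p)"
    using p q n by (simp add: divide_ennreal_def inverse_ennreal ennreal_mult mult_ac)
  finally show ?thesis .
qed

text \<open>
  Write \<open>W\<close> and \<open>S\<close> for the measures with densities \<open>w\<close> and \<open>s = 1/w\<close>, and \<open>G\<close> for the maximal function of
  \<open>h w\<close> with respect to \<open>S\<close>. On \<open>Q\<close> the function \<open>G\<close> is at least \<open>(\<integral>\<^sub>Q h) / S(Q)\<close>; averaging this over \<open>Q\<close> and using
  the A2 condition bounds the mean of \<open>h\<close> by \<open>C\<close> times the \<open>W\<close>-mean of \<open>G s\<close>. Hence the maximal function of \<open>h\<close>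
  is at most \<open>C\<close> times the \<open>W\<close>-maximal function of \<open>G s\<close>. Applying Doob's inequality for \<open>W\<close> and then for \<open>S\<close>
  costs a factor 4 each, whatever the weight is; the condition \<open>w s = 1\<close> makes the integrals match.
\<close>

lemma maxfn_weighted_L2:
  assumes sf: "sigma_finite_measure N"
    and D: "countable D" "laminar D" "D \<subseteq> sets N"
    and D_fin: "\<And>Q. Q \<in> D \<Longrightarrow> 0 < emeasure N Q \<and> emeasure N Q < \<infinity>"
    and [measurable]: "w \<in> borel_measurable N" "s \<in> borel_measurable N" "h \<in> borel_measurable N"
    and ws: "AE x in N. w x * s x = 1"
    and w_fin: "\<And>Q. Q \<in> D \<Longrightarrow> (\<integral>\<^sup>+x\<in>Q. w x \<partial>N) < \<infinity>"
    and s_fin: "\<And>Q. Q \<in> D \<Longrightarrow> (\<integral>\<^sup>+x\<in>Q. s x \<partial>N) < \<infinity>"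
    and A2: "\<And>Q. Q \<in> D \<Longrightarrow> (\<integral>\<^sup>+x\<in>Q. w x \<partial>N) * (\<integral>\<^sup>+x\<in>Q. s x \<partial>N) \<le> C * (emeasure N Q)^2"
  shows "(\<integral>\<^sup>+x. (maxfn N D h x)^2 * w x \<partial>N) \<le> 16 * C^2 * (\<integral>\<^sup>+x. (h x)^2 * w x \<partial>N)"
proof -
  interpret sigma_finite_measure N by fact
  define W where "W = density N w"
  define S where "S = density N s"
  have sets_W [simp, measurable_cong]: "sets W = sets N" and sets_S [simp, measurable_cong]: "sets S = sets N"
    by (auto simp: W_def S_def)
  have w_s: "AE x in N. w x \<noteq> \<infinity> \<and> s x \<noteq> \<infinity> \<and> 0 < w x \<and> 0 < s x"
    using ws by eventually_elim
      (auto simp: ennreal_top_mult ennreal_mult_top zero_less_iff_neq_zero split: if_splits)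
  have sigma: "sigma_finite_measure W" "sigma_finite_measure S"
    using w_s unfolding W_def S_def
    by (simp_all add: sigma_finite_iff_density_finite eventually_conj_iff)
  have em: "emeasure W Q = (\<integral>\<^sup>+x\<in>Q. w x \<partial>N)" "emeasure S Q = (\<integral>\<^sup>+x\<in>Q. s x \<partial>N)" if "Q \<in> D" for Q
    using that D by (auto simp: W_def S_def emeasure_density)
  define G where "G = maxfn S D (\<lambda>x. h x * w x)"
  define F where "F = maxfn W D (\<lambda>x. G x * s x)"
  have [measurable]: "G \<in> borel_measurable N" "F \<in> borel_measurable N" "maxfn N D h \<in> borel_measurable N"
    unfolding G_def F_def using D by (auto intro!: maxfn_measurable_cong)
  have le: "maxfn N D h x \<le> C * F x" for x
    unfolding maxfn_def
  proof (rule SUP_least)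
    fix Q assume Q: "Q \<in> D"
    then have [measurable]: "Q \<in> sets N" using D by auto
    let ?a = "\<integral>\<^sup>+x\<in>Q. h x \<partial>N"
    show "mean N h Q * indicator Q x \<le> C * F x"
    proof (cases "x \<in> Q")
      case True
      have "mean S (\<lambda>x. h x * w x) Q = ?a / emeasure S Q"
      proof -
        have "(\<integral>\<^sup>+x\<in>Q. h x * w x \<partial>S) = (\<integral>\<^sup>+x. s x * (h x * w x * indicator Q x) \<partial>N)"
          unfolding S_def by (subst nn_integral_density) auto
        also have "\<dots> = ?a"
          using ws by (intro nn_integral_cong_AE) (auto elim!: eventually_mono simp: indicator_def mult_ac)
        finally show ?thesis unfolding mean_def by simp
      qed
      then have G: "?a / emeasure S Q \<le> G y" if "y \<in> Q" for y
        unfolding G_def maxfn_def using that by (intro SUP_upper2[OF Q]) auto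
      have "?a / emeasure S Q * emeasure N Q = (\<integral>\<^sup>+y\<in>Q. ?a / emeasure S Q \<partial>N)"
        by (simp add: nn_integral_cmult_indicator)
      also have "\<dots> \<le> (\<integral>\<^sup>+y\<in>Q. G y \<partial>N)"
        using G by (intro nn_integral_mono) (auto simp: indicator_def)
      also have "\<dots> = (\<integral>\<^sup>+y. w y * (G y * s y * indicator Q y) \<partial>N)"
        using ws by (intro nn_integral_cong_AE) (auto elim!: eventually_mono simp: indicator_def mult_ac)
      also have "\<dots> = (\<integral>\<^sup>+y\<in>Q. G y * s y \<partial>W)"
        unfolding W_def by (subst nn_integral_density) auto
      finally have "(?a / emeasure S Q * emeasure N Q) / emeasure W Q \<le> mean W (\<lambda>y. G y * s y) Q"
        unfolding mean_def by (intro divide_right_mono_ennreal)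
      also have "\<dots> \<le> F x"
        unfolding F_def maxfn_def using True by (intro SUP_upper2[OF Q]) auto
      finally have *: "(?a / emeasure S Q * emeasure N Q) / emeasure W Q \<le> F x" .
      have pos: "0 < emeasure W Q" "0 < emeasure S Q"
        using w_s D_fin[OF Q] unfolding em[OF Q]
        by (auto intro!: emeasure_density_pos elim!: eventually_mono)
      have "?a / emeasure N Q \<le> C * ((?a / emeasure S Q * emeasure N Q) / emeasure W Q)"
        using pos w_fin[OF Q] s_fin[OF Q] D_fin[OF Q] A2[OF Q] em[OF Q]
        by (intro A2_average_algebra) auto
      also have "\<dots> \<le> C * F x" using * by (intro mult_left_mono) auto
      finally show ?thesis using True by (simp add: mean_def)
    qed simp
  qed
  have "(\<integral>\<^sup>+x. (maxfn N D h x)^2 * w x \<partial>N) \<le> (\<integral>\<^sup>+x. C^2 * (w x * (F x)^2) \<partial>N)"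
  proof (rule nn_integral_mono)
    fix x
    have "(maxfn N D h x)^2 \<le> (C * F x)^2" by (intro power_mono le) auto
    then have "(maxfn N D h x)^2 * w x \<le> (C * F x)^2 * w x" by (rule mult_right_mono) auto
    then show "(maxfn N D h x)^2 * w x \<le> C^2 * (w x * (F x)^2)"
      by (simp add: power_mult_distrib mult_ac)
  qed
  also have "\<dots> = C^2 * (\<integral>\<^sup>+x. (F x)^2 \<partial>W)"
    unfolding W_def by (subst nn_integral_density) (auto simp: nn_integral_cmult)
  also have "\<dots> \<le> C^2 * (4 * (\<integral>\<^sup>+x. (G x * s x)^2 \<partial>W))"
    unfolding F_def using D w_fin em sigma by (intro mult_left_mono maxfn_L2) auto
  also have "(\<integral>\<^sup>+x. (G x * s x)^2 \<partial>W) = (\<integral>\<^sup>+x. w x * (G x * s x)^2 \<partial>N)"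
    unfolding W_def by (subst nn_integral_density) auto
  also have "\<dots> = (\<integral>\<^sup>+x. s x * (G x)^2 \<partial>N)"
  proof (intro nn_integral_cong_AE, use ws in eventually_elim)
    fix x assume "w x * s x = 1"
    moreover have "w x * (G x * s x)^2 = (w x * s x) * (s x * (G x)^2)"
      by (simp add: power2_eq_square mult_ac)
    ultimately show "w x * (G x * s x)^2 = s x * (G x)^2" by simp
  qed
  also have "\<dots> = (\<integral>\<^sup>+x. (G x)^2 \<partial>S)"
    unfolding S_def by (subst nn_integral_density) auto
  also have "C^2 * (4 * \<dots>) \<le> C^2 * (4 * (4 * (\<integral>\<^sup>+x. (h x * w x)^2 \<partial>S)))"
    unfolding G_def using D s_fin em sigma by (intro mult_left_mono maxfn_L2) auto
  also have "(\<integral>\<^sup>+x. (h x * w x)^2 \<partial>S) = (\<integral>\<^sup>+x. s x * (h x * w x)^2 \<partial>N)"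
    unfolding S_def by (subst nn_integral_density) auto
  also have "\<dots> = (\<integral>\<^sup>+x. (h x)^2 * w x \<partial>N)"
  proof (intro nn_integral_cong_AE, use ws in eventually_elim)
    fix x assume "w x * s x = 1"
    moreover have "s x * (h x * w x)^2 = (w x * s x) * ((h x)^2 * w x)"
      by (simp add: power2_eq_square mult_ac)
    ultimately show "s x * (h x * w x)^2 = (h x)^2 * w x" by simp
  qed
  finally show ?thesis by (simp add: mult_ac)
qed

section \<open>Shifted dyadic grids\<close>

text \<open>
  Generation \<open>k\<close> of a shifted grid is translated by one third of its side length \<open>2^k\<close>, with a sign that alternates
  with \<open>k\<close>. The alternation keeps the generations nested: from \<open>k\<close> to \<open>k + 1\<close> the origin moves by
  \<open>2^k / 3 + 2^(k+1) / 3 = 2^k\<close>, which is a multiple of the smaller side length.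
\<close>

definition grid_shift :: "bool \<Rightarrow> int \<Rightarrow> real" where
  "grid_shift b k = (if b then (if even k then 1/3 else - 1/3) else 0)"

text \<open>
  A cell is the set of points with prescribed integer parts, that is, a half-open cube of side length \<open>2^k\<close>. The index
  \<open>\<alpha>\<close> selects the coordinates in which the grid is shifted, so there are \<open>2^d\<close> grids.
\<close>

definition dyadic_cell :: "('d \<Rightarrow> bool) \<Rightarrow> int \<Rightarrow> ('d \<Rightarrow> int) \<Rightarrow> (real ^ 'd) set" where
  "dyadic_cell \<alpha> k m = {x. \<forall>i. \<lfloor>x $ i / 2 powi k - grid_shift (\<alpha> i) k\<rfloor> = m i}"

definition grid :: "('d \<Rightarrow> bool) \<Rightarrow> (real ^ 'd) set set" where
  "grid \<alpha> = {dyadic_cell \<alpha> k m | k m. True}"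

lemma countable_grid: "countable (grid \<alpha> :: (real ^ 'd) set set)"
proof -
  have "grid \<alpha> = (\<lambda>(k, m). dyadic_cell \<alpha> k m) ` UNIV" by (auto simp: grid_def)
  then show ?thesis by simp
qed

lemma floor_divide_cong:
  fixes u v :: real and n :: int
  assumes "0 < n" "\<lfloor>u\<rfloor> = \<lfloor>v\<rfloor>"
  shows "\<lfloor>u / of_int n\<rfloor> = \<lfloor>v / of_int n\<rfloor>"
  using assms floor_divide_real_eq_div[of n u] floor_divide_real_eq_div[of n v] by simp

text \<open>
  Consecutive generations are nested: up to the integer \<open>j\<close>, the coordinate that determines the parent
  is half of the one that determines the child, and halving respects equality of integer parts.
\<close>

lemma floor_parent_cong:
  fixes x y :: real
  assumes "\<lfloor>x / 2 powi k - grid_shift b k\<rfloor>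
         = \<lfloor>y / 2 powi k - grid_shift b k\<rfloor>"
  shows "\<lfloor>x / 2 powi (k + 1) - grid_shift b (k + 1)\<rfloor>
       = \<lfloor>y / 2 powi (k + 1) - grid_shift b (k + 1)\<rfloor>"
proof -
  define c :: real where "c = grid_shift b k"
  \<comment> \<open>up to sign, the number of child cells between the origins of the two generations\<close>
  define j :: int where "j = (if b then (if even k then 1 else - 1) else 0)"
  have c': "grid_shift b (k + 1) = - c"
    by (simp add: c_def grid_shift_def)
  have c3: "3 * c = of_int j" by (simp add: c_def j_def grid_shift_def)
  have step: "z / 2 powi (k + 1) - (- c) = (z / 2 powi k - c + of_int j) / of_int 2" for z :: real
    unfolding c3[symmetric] by (simp add: power_int_add field_simps)
  have "\<lfloor>x / 2 powi k - c + of_int j\<rfloor> = \<lfloor>y / 2 powi k - c + of_int j\<rfloor>"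
    using assms by (simp add: c_def[symmetric])
  then show ?thesis unfolding c' step by (intro floor_divide_cong) auto
qed

lemma floor_ancestor_cong:
  fixes x y :: real
  assumes "\<lfloor>x / 2 powi k - grid_shift b k\<rfloor>
         = \<lfloor>y / 2 powi k - grid_shift b k\<rfloor>" and "k \<le> l"
  shows "\<lfloor>x / 2 powi l - grid_shift b l\<rfloor>
       = \<lfloor>y / 2 powi l - grid_shift b l\<rfloor>"
  using assms(2)
proof (induction rule: int_ge_induct)
  case base show ?case by (rule assms(1))
next
  case (step l) then show ?case by (intro floor_parent_cong)
qed

lemma laminar_grid: "laminar (grid \<alpha>)"
proof -
  have *: "dyadic_cell \<alpha> k m \<inter> dyadic_cell \<alpha> l n = {} \<or> dyadic_cell \<alpha> k m \<subseteq> dyadic_cell \<alpha> l n"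
    if "k \<le> l" for k l m n
  proof (rule disjCI)
    assume "\<not> dyadic_cell \<alpha> k m \<subseteq> dyadic_cell \<alpha> l n"
    then obtain x where x: "x \<in> dyadic_cell \<alpha> k m" "x \<notin> dyadic_cell \<alpha> l n" by auto
    show "dyadic_cell \<alpha> k m \<inter> dyadic_cell \<alpha> l n = {}"
    proof (rule ccontr)
      assume "dyadic_cell \<alpha> k m \<inter> dyadic_cell \<alpha> l n \<noteq> {}"
      then obtain y where y: "y \<in> dyadic_cell \<alpha> k m" "y \<in> dyadic_cell \<alpha> l n" by auto
      have "x \<in> dyadic_cell \<alpha> l n"
        unfolding dyadic_cell_def
      proof (intro CollectI allI)
        fix i
        have "\<lfloor>x $ i / 2 powi l - grid_shift (\<alpha> i) l\<rfloor>
            = \<lfloor>y $ i / 2 powi l - grid_shift (\<alpha> i) l\<rfloor>"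
          using x(1) y(1) by (intro floor_ancestor_cong[OF _ that]) (simp add: dyadic_cell_def)
        also have "\<dots> = n i" using y(2) by (simp add: dyadic_cell_def)
        finally show "\<lfloor>x $ i / 2 powi l - grid_shift (\<alpha> i) l\<rfloor> = n i" .
      qed
      with x(2) show False by simp
    qed
  qed
  show ?thesis unfolding laminar_def
  proof (intro ballI)
    fix P Q assume "P \<in> grid \<alpha>" "Q \<in> grid \<alpha>"
    then obtain k m l n where PQ: "P = dyadic_cell \<alpha> k m" "Q = dyadic_cell \<alpha> l n" by (auto simp: grid_def)
    show "P \<inter> Q = {} \<or> P \<subseteq> Q \<or> Q \<subseteq> P"
      using *[of k l m n] *[of l k n m] unfolding PQ by (cases "k \<le> l") (auto simp: Int_commute)
  qed
qed

lemma emeasure_cube: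
  fixes a :: "real ^ 'd"
  assumes "0 \<le> l"
  shows "emeasure lebesgue (cbox a (a + (\<chi> i. l))) = ennreal (l ^ CARD('d))"
    and "emeasure lebesgue (box a (a + (\<chi> i. l))) = ennreal (l ^ CARD('d))"
proof -
  have "(\<Prod>b\<in>Basis. (a + (\<chi> i. l) - a) \<bullet> b) = (\<Prod>b\<in>(Basis :: (real^'d) set). l)"
    by (intro prod.cong) (auto simp: Basis_vec_def inner_axis)
  then have *: "(\<Prod>b\<in>Basis. (a + (\<chi> i. l) - a) \<bullet> b) = l ^ CARD('d)" by simp
  have le: "\<And>b. b \<in> Basis \<Longrightarrow> a \<bullet> b \<le> (a + (\<chi> i. l)) \<bullet> b"
    using assms by (auto simp: Basis_vec_def inner_axis inner_add_left)
  show "emeasure lebesgue (cbox a (a + (\<chi> i. l))) = ennreal (l ^ CARD('d))"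
    using emeasure_lborel_cbox[OF le] * by simp
  show "emeasure lebesgue (box a (a + (\<chi> i. l))) = ennreal (l ^ CARD('d))"
    using emeasure_lborel_box[OF le] * by simp
qed

text \<open>
  The two inclusions give the measure of a cell without a direct computation for half-open cubes.
\<close>

lemma dyadic_cell_cube:
  fixes \<alpha> :: "'d::finite \<Rightarrow> bool"
  obtains a where "box a (a + (\<chi> i. 2 powi k)) \<subseteq> dyadic_cell \<alpha> k m"
    "dyadic_cell \<alpha> k m \<subseteq> cbox a (a + (\<chi> i. 2 powi k))"
proof -
  define c where "c i = grid_shift (\<alpha> i) k" for i
  define p :: real where "p = 2 powi k"
  have p: "0 < p" by (simp add: p_def)
  define a :: "real ^ 'd" where "a = (\<chi> i. p * (of_int (m i) + c i))"
  have cell: "dyadic_cell \<alpha> k m = {x. \<forall>i. a $ i \<le> x $ i \<and> x $ i < a $ i + p}"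
    using p by (auto simp: dyadic_cell_def c_def[symmetric] p_def[symmetric] floor_eq_iff a_def field_simps)
  show thesis
  proof (rule that[of a, folded p_def])
    show "box a (a + (\<chi> i. p)) \<subseteq> dyadic_cell \<alpha> k m"
      unfolding cell by (auto simp: mem_box_cart less_imp_le)
    show "dyadic_cell \<alpha> k m \<subseteq> cbox a (a + (\<chi> i. p))"
      unfolding cell by (auto simp: mem_box_cart less_imp_le)
  qed
qed

lemma dyadic_cell_sets: "(dyadic_cell \<alpha> k m :: (real^'d) set) \<in> sets lebesgue"
proof -
  have [measurable]: "(\<lambda>x::real^'d. x $ i) \<in> borel_measurable borel" for i
    by (intro borel_measurable_continuous_onI continuous_intros)
  have "{x\<in>space (borel :: (real^'d) measure). \<forall>i. \<lfloor>x $ i / 2 powi k - grid_shift (\<alpha> i) k\<rfloor> = m i} \<in> sets borel"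
    by measurable
  then show ?thesis by (simp add: dyadic_cell_def sets_completionI_sets)
qed

lemma emeasure_dyadic_cell:
  "emeasure lebesgue (dyadic_cell \<alpha> k m :: (real^'d) set) = ennreal ((2 powi k) ^ CARD('d))"
proof -
  obtain a where a: "box a (a + (\<chi> i. 2 powi k)) \<subseteq> dyadic_cell \<alpha> k m"
    "dyadic_cell \<alpha> k m \<subseteq> cbox a (a + (\<chi> i. 2 powi k))" by (rule dyadic_cell_cube)
  have "(0::real) \<le> 2 powi k" by simp
  from emeasure_cube[OF this, of a] show ?thesis
    using emeasure_mono[OF a(1), of lebesgue] emeasure_mono[OF a(2), of lebesgue] dyadic_cell_sets[of \<alpha> k m]
    by (intro antisym) auto
qed

lemma grid_subset_cube:
  fixes \<alpha> :: "'d::finite \<Rightarrow> bool"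
  assumes "Q \<in> grid \<alpha>"
  obtains I where "I \<in> cubes" "Q \<subseteq> I" "emeasure lebesgue I = emeasure lebesgue Q"
    "0 < emeasure lebesgue Q" "emeasure lebesgue Q < \<infinity>" "Q \<in> sets lebesgue"
proof -
  obtain k m where Q: "Q = dyadic_cell \<alpha> k m" using assms by (auto simp: grid_def)
  obtain a where a: "dyadic_cell \<alpha> k m \<subseteq> cbox a (a + (\<chi> i. 2 powi k))" using dyadic_cell_cube by blast
  show thesis
  proof (rule that)
    show "cbox a (a + (\<chi> i. 2 powi k)) \<in> cubes" unfolding cubes_def by force
  qed (use a Q emeasure_cube[of "2 powi k" a] emeasure_dyadic_cell[of \<alpha> k m] dyadic_cell_sets[of \<alpha> k m] in auto)
qed

text \<open>
  A cell boundary of the unshifted grid and one of the shifted grid are at distance at least \<open>1/3\<close>, so an interval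
  shorter than that cannot cross both.
\<close>

lemma one_third_trick:
  fixes x l c :: real
  assumes "0 \<le> l" "3 * l < 1" and c: "c = 1/3 \<or> c = - 1/3"
  shows "\<exists>b. \<lfloor>x - (if b then c else 0)\<rfloor> = \<lfloor>x + l - (if b then c else 0)\<rfloor>"
proof (rule ccontr)
  assume *: "\<not> ?thesis"
  have jump: "\<lfloor>y\<rfloor> < \<lfloor>y + l\<rfloor>" if "\<lfloor>y\<rfloor> \<noteq> \<lfloor>y + l\<rfloor>" for y
    using that floor_mono[of y "y + l"] assms(1) by linarith
  define m n where "m = \<lfloor>x + l\<rfloor>" and "n = \<lfloor>x - c + l\<rfloor>"
  have "\<lfloor>x\<rfloor> < m" "\<lfloor>x - c\<rfloor> < n"
    using * jump[of x] jump[of "x - c"] unfolding m_def n_def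
    by (auto simp: algebra_simps dest: spec[of _ True] spec[of _ False])
  then have "x < of_int m" "x - c < of_int n" by (simp_all add: floor_less_iff)
  moreover have "of_int m \<le> x + l" "of_int n \<le> x - c + l" by (simp_all add: m_def n_def)
  moreover define d where "d = m - n"
  ultimately have d: "\<bar>real_of_int d - c\<bar> < 1/3" using assms(2) by (simp only: of_int_diff)
  from c show False
  proof
    assume "c = 1/3"
    then have "real_of_int 0 < real_of_int d" "real_of_int d < real_of_int 1" using d by linarith+
    then show False unfolding of_int_less_iff by simp
  next
    assume "c = - 1/3"
    then have "real_of_int (-1) < real_of_int d" "real_of_int d < real_of_int 0" using d by linarith+
    then show False unfolding of_int_less_iff by simp
  qed
qed

text \<open>
  The grid is selected coordinate by coordinate with the one-third trick, at the generation whose side length lies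
  between \<open>3 l\<close> and \<open>6 l\<close>.
\<close>

lemma cube_subset_grid:
  fixes I :: "(real ^ 'd) set"
  assumes "I \<in> cubes"
  obtains \<alpha> Q where "Q \<in> grid \<alpha>" "I \<subseteq> Q" "emeasure lebesgue Q \<le> 6 ^ CARD('d) * emeasure lebesgue I"
proof -
  obtain a l where I: "I = cbox a (a + (\<chi> i. l))" "0 < l" using assms by (auto simp: cubes_def)
  \<comment> \<open>the least \<open>k\<close> with \<open>3 l < 2^k\<close>\<close>
  define k where "k = \<lfloor>log 2 (3 * l)\<rfloor> + 1"
  have k1: "3 * l < 2 powi k" and k2: "2 powi k \<le> 6 * l"
  proof -
    have "log 2 (3 * l) < of_int k" "of_int k \<le> log 2 (3 * l) + 1" unfolding k_def by linarith+
    then have "2 powr (log 2 (3 * l)) < 2 powr (of_int k)" "2 powr (of_int k) \<le> 2 powr (log 2 (3 * l) + 1)"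
      by auto
    then show "3 * l < 2 powi k" "2 powi k \<le> 6 * l"
      using I(2) by (auto simp: powr_add powr_real_of_int')
  qed
  define p :: real where "p = 2 powi k"
  have p: "0 < p" by (simp add: p_def)
  define c :: real where "c = (if even k then 1/3 else - 1/3)"
  have shift: "grid_shift b k = (if b then c else 0)" for b by (simp add: grid_shift_def c_def)
  have "\<exists>b. \<lfloor>a $ i / p - (if b then c else 0)\<rfloor> = \<lfloor>a $ i / p + l / p - (if b then c else 0)\<rfloor>" for i
    using p I(2) k1 by (intro one_third_trick) (auto simp: c_def field_simps p_def)
  then obtain \<alpha> where \<alpha>: "\<And>i. \<lfloor>a $ i / p - (if \<alpha> i then c else 0)\<rfloor> = \<lfloor>a $ i / p + l / p - (if \<alpha> i then c else 0)\<rfloor>"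
    by metis
  define m where "m i = \<lfloor>a $ i / p - (if \<alpha> i then c else 0)\<rfloor>" for i
  show thesis
  proof (rule that)
    show "dyadic_cell \<alpha> k m \<in> grid \<alpha>" by (auto simp: grid_def)
    show "I \<subseteq> dyadic_cell \<alpha> k m"
      unfolding dyadic_cell_def p_def[symmetric] shift
    proof (intro subsetI CollectI allI)
      fix x i assume "x \<in> I"
      then have "a $ i \<le> x $ i" "x $ i \<le> a $ i + l" by (auto simp: I mem_box_cart)
      then have "a $ i / p - (if \<alpha> i then c else 0) \<le> x $ i / p - (if \<alpha> i then c else 0)"
        "x $ i / p - (if \<alpha> i then c else 0) \<le> a $ i / p + l / p - (if \<alpha> i then c else 0)"
        using p by (auto simp: field_simps)
      then show "\<lfloor>x $ i / p - (if \<alpha> i then c else 0)\<rfloor> = m i"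
        using floor_mono \<alpha>[of i] unfolding m_def by (metis antisym)
    qed
    have "p ^ CARD('d) \<le> (6 * l) ^ CARD('d)" using k2 p by (intro power_mono) (auto simp: p_def)
    then have "ennreal (p ^ CARD('d)) \<le> ennreal (6 ^ CARD('d) * l ^ CARD('d))"
      by (intro ennreal_leI) (simp add: power_mult_distrib)
    then show "emeasure lebesgue (dyadic_cell \<alpha> k m) \<le> 6 ^ CARD('d) * emeasure lebesgue I"
      using I emeasure_cube[of l a] p
      by (simp add: emeasure_dyadic_cell p_def[symmetric] ennreal_mult flip: ennreal_power)
  qed
qed

section \<open>The maximal operator of the shifted grids and its sharp A2 bound\<close>

lemma cubeD:
  assumes "I \<in> cubes"
  shows "I \<in> sets lebesgue" "0 < emeasure lebesgue I" "emeasure lebesgue I < \<infinity>" "compact I"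
proof -
  obtain a l where I: "I = cbox a (a + (\<chi> i. l))" "0 < l" using assms by (auto simp: cubes_def)
  then show "I \<in> sets lebesgue" "compact I" by auto
  show "0 < emeasure lebesgue I" "emeasure lebesgue I < \<infinity>"
    using I emeasure_cube[of l a] by auto
qed

lemma bounded_subset_cube:
  fixes E :: "(real ^ 'd) set"
  assumes "bounded E"
  obtains I where "I \<in> cubes" "E \<subseteq> I"
proof -
  obtain r where r: "0 < r" "\<And>x. x \<in> E \<Longrightarrow> norm x \<le> r" using assms bounded_pos by metis
  show thesis
  proof (rule that)
    show "cbox (\<chi> i. - r) ((\<chi> i. - r) + (\<chi> i. 2 * r)) \<in> (cubes :: (real ^ 'd) set set)"
      unfolding cubes_def using r(1) by force
    show "E \<subseteq> cbox (\<chi> i. - r) ((\<chi> i. - r) + (\<chi> i. 2 * r))"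
    proof
      fix x assume "x \<in> E"
      then have "\<bar>x $ i\<bar> \<le> r" for i using r(2) component_le_norm_cart[of x i] by force
      then show "x \<in> cbox (\<chi> i. - r) ((\<chi> i. - r) + (\<chi> i. 2 * r))"
        by (auto simp: mem_box_cart abs_le_iff minus_le_iff)
    qed
  qed
qed

lemma average_mult:
  assumes "I \<in> cubes"
  shows "average u I * emeasure lebesgue I = (\<integral>\<^sup>+x\<in>I. ennreal (u x) \<partial>lebesgue)"
  using cubeD(2,3)[OF assms] unfolding average_def
  by (simp add: ennreal_divide_times less_top)

lemma weight_integral_finite:
  assumes "weight w" "I \<in> cubes"
  shows "(\<integral>\<^sup>+x\<in>I. ennreal (w x) \<partial>lebesgue) < \<infinity>"
proof -
  have w: "AE x in lebesgue. 0 < w x" "set_integrable lebesgue I w"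
    using assms cubeD(4) by (auto simp: weight_def)
  have "(\<integral>\<^sup>+x\<in>I. ennreal (w x) \<partial>lebesgue) = (\<integral>\<^sup>+x. ennreal (norm (indicator I x *\<^sub>R w x)) \<partial>lebesgue)"
    using w(1) by (intro nn_integral_cong_AE) (auto elim!: eventually_mono simp: indicator_def)
  also have "\<dots> < \<infinity>" using w(2) unfolding set_integrable_def integrable_iff_bounded by auto
  finally show ?thesis .
qed

lemma weight_average_pos:
  assumes "weight w" "I \<in> cubes"
  shows "0 < average w I" "average w I < \<infinity>"
proof -
  have "0 < (\<integral>\<^sup>+x\<in>I. ennreal (w x) \<partial>lebesgue)"
    using assms cubeD[OF assms(2)] by (intro emeasure_density_pos) (auto simp: weight_def)
  then show "0 < average w I" "average w I < \<infinity>"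
    using weight_integral_finite[OF assms] cubeD[OF assms(2)]
    by (auto simp: average_def ennreal_zero_less_divide less_top[symmetric] ennreal_divide_eq_top_iff)
qed

text \<open>
  The first claim holds because the A2 product is finite and its factor \<open>average w I\<close> is positive.
\<close>

lemma A2_cube:
  assumes "A2 w" and I: "I \<in> cubes"
  shows "(\<integral>\<^sup>+x\<in>I. ennreal (inverse (w x)) \<partial>lebesgue) < \<infinity>"
    and "(\<integral>\<^sup>+x\<in>I. ennreal (inverse (w x)) \<partial>lebesgue) * (\<integral>\<^sup>+x\<in>I. ennreal (w x) \<partial>lebesgue)
      \<le> A2_const w * (emeasure lebesgue I)^2"
proof -
  have w: "weight w" "A2_const w < \<infinity>" using assms by (auto simp: A2_def)
  have le: "average w I * average (\<lambda>x. inverse (w x)) I \<le> A2_const w"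
    unfolding A2_const_def by (rule SUP_upper[OF I])
  have "average (\<lambda>x. inverse (w x)) I < \<infinity>"
    using le w weight_average_pos[OF w(1) I]
    by (auto simp: less_top[symmetric] top_unique ennreal_mult_eq_top_iff)
  then show "(\<integral>\<^sup>+x\<in>I. ennreal (inverse (w x)) \<partial>lebesgue) < \<infinity>"
    using cubeD[OF I] unfolding average_mult[OF I, symmetric] by (auto simp: ennreal_mult_less_top)
  have "average w I * average (\<lambda>x. inverse (w x)) I * (emeasure lebesgue I)^2 \<le> A2_const w * (emeasure lebesgue I)^2"
    using le by (rule mult_right_mono) auto
  then show "(\<integral>\<^sup>+x\<in>I. ennreal (inverse (w x)) \<partial>lebesgue) * (\<integral>\<^sup>+x\<in>I. ennreal (w x) \<partial>lebesgue)
      \<le> A2_const w * (emeasure lebesgue I)^2"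
    unfolding average_mult[OF I, symmetric] by (simp add: power2_eq_square mult_ac)
qed

lemma A2_const_pos:
  fixes w :: "real ^ 'd \<Rightarrow> real"
  assumes "A2 w"
  shows "0 < A2_const w"
proof -
  obtain I :: "(real ^ 'd) set" where I: "I \<in> cubes" using bounded_subset_cube[of "{}"] by auto
  have w: "weight w" using assms by (auto simp: A2_def)
  have [measurable]: "w \<in> borel_measurable lebesgue" using w by (simp add: weight_def)
  have "0 < (\<integral>\<^sup>+x\<in>I. ennreal (inverse (w x)) \<partial>lebesgue)"
    using w cubeD[OF I] by (intro emeasure_density_pos) (auto simp: weight_def)
  moreover have "0 < (\<integral>\<^sup>+x\<in>I. ennreal (w x) \<partial>lebesgue)"
    using w cubeD[OF I] by (intro emeasure_density_pos) (auto simp: weight_def)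
  ultimately show ?thesis using A2_cube(2)[OF assms I]
    by (auto simp: zero_less_iff_neq_zero)
qed

definition grid_max :: "(real ^ 'd \<Rightarrow> ennreal) \<Rightarrow> real ^ 'd \<Rightarrow> ennreal" where
  "grid_max h x = (SUP \<alpha>. maxfn lebesgue (grid \<alpha>) h x)"

lemma grid_sets: "grid \<alpha> \<subseteq> sets lebesgue"
  using grid_subset_cube by blast

lemma grid_max_measurable [measurable]: "grid_max h \<in> borel_measurable lebesgue"
proof -
  have "(\<lambda>x. SUP \<alpha>. maxfn lebesgue (grid \<alpha>) h x) \<in> borel_measurable lebesgue"
    using grid_sets countable_grid by (intro borel_measurable_SUP maxfn_measurable) auto
  then show ?thesis unfolding grid_max_def[abs_def] .
qed

lemma mean_le_grid_max: "Q \<in> grid \<alpha> \<Longrightarrow> x \<in> Q \<Longrightarrow> mean lebesgue h Q \<le> grid_max h x"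
  unfolding grid_max_def maxfn_def by (rule SUP_upper2[of \<alpha>], simp, rule SUP_upper2[of Q]) auto

lemma sigma_finite_lebesgue: "sigma_finite_measure (lebesgue :: 'a::euclidean_space measure)"
proof
  have "(\<Union>n. cball 0 (real n)) = (UNIV :: 'a set)"
    by (auto simp: mem_cball intro: real_arch_simple)
  then show "\<exists>A. countable A \<and> A \<subseteq> sets lebesgue \<and> \<Union>A = space (lebesgue :: 'a measure)
      \<and> (\<forall>a\<in>A. emeasure lebesgue a \<noteq> \<infinity>)"
    using fmeasurableD2[OF lmeasurable_cball]
    by (intro exI[of _ "range (\<lambda>n. cball 0 (real n))"]) auto
qed

text \<open>
  Lerner's bound is applied with the roles of \<open>w\<close> and \<open>1/w\<close> exchanged. Cells inherit the A2 condition from the closed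
  cubes of the same measure that contain them. The maximum over the grids is estimated by a sum, which
  accounts for the factor that counts the grids.
\<close>

lemma grid_max_A2_bound:
  fixes w :: "real ^ 'd \<Rightarrow> real"
  assumes w: "A2 w" and [measurable]: "h \<in> borel_measurable lebesgue"
  shows "(\<integral>\<^sup>+x. (grid_max h x)^2 * ennreal (inverse (w x)) \<partial>lebesgue)
    \<le> of_nat CARD('d \<Rightarrow> bool) * (16 * (A2_const w)^2 * (\<integral>\<^sup>+x. (h x)^2 * ennreal (inverse (w x)) \<partial>lebesgue))"
proof -
  have W: "weight w" using w by (simp add: A2_def)
  then have [measurable]: "w \<in> borel_measurable lebesgue" by (simp add: weight_def)
  have ws: "AE x in lebesgue. ennreal (inverse (w x)) * ennreal (w x) = 1"
    using W by (auto simp: weight_def ennreal_mult[symmetric] elim!: eventually_mono)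
  let ?R = "16 * (A2_const w)^2 * (\<integral>\<^sup>+x. (h x)^2 * ennreal (inverse (w x)) \<partial>lebesgue)"
  have one: "(\<integral>\<^sup>+x. (maxfn lebesgue (grid \<alpha>) h x)^2 * ennreal (inverse (w x)) \<partial>lebesgue) \<le> ?R" for \<alpha>
  proof (rule maxfn_weighted_L2[where s = "\<lambda>x. ennreal (w x)"])
    show "sigma_finite_measure (lebesgue :: (real ^ 'd) measure)"
      by (rule sigma_finite_lebesgue)
    show "countable (grid \<alpha>)" "laminar (grid \<alpha>)" "grid \<alpha> \<subseteq> sets lebesgue"
      by (rule countable_grid laminar_grid grid_sets)+
    show "AE x in lebesgue. ennreal (inverse (w x)) * ennreal (w x) = 1" by fact
    fix Q assume "Q \<in> grid \<alpha>"
    then obtain I where I: "I \<in> cubes" "Q \<subseteq> I" "emeasure lebesgue I = emeasure lebesgue Q"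
      "0 < emeasure lebesgue Q" "emeasure lebesgue Q < \<infinity>" "Q \<in> sets lebesgue" by (rule grid_subset_cube)
    show "0 < emeasure lebesgue Q \<and> emeasure lebesgue Q < \<infinity>" using I by auto
    have mono: "(\<integral>\<^sup>+x\<in>Q. f x \<partial>lebesgue) \<le> (\<integral>\<^sup>+x\<in>I. f x \<partial>lebesgue)" for f
      using I(2) by (intro nn_integral_mono) (auto simp: indicator_def)
    show "(\<integral>\<^sup>+x\<in>Q. ennreal (inverse (w x)) \<partial>lebesgue) < \<infinity>"
      using mono A2_cube(1)[OF w I(1)] by (rule le_less_trans)
    show "(\<integral>\<^sup>+x\<in>Q. ennreal (w x) \<partial>lebesgue) < \<infinity>"
      using mono weight_integral_finite[OF W I(1)] by (rule le_less_trans)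
    show "(\<integral>\<^sup>+x\<in>Q. ennreal (inverse (w x)) \<partial>lebesgue) * (\<integral>\<^sup>+x\<in>Q. ennreal (w x) \<partial>lebesgue)
        \<le> A2_const w * (emeasure lebesgue Q)^2"
      unfolding I(3)[symmetric] by (rule order_trans[OF mult_mono[OF mono mono] A2_cube(2)[OF w I(1)]]) auto
  qed auto
  have [measurable]: "maxfn lebesgue (grid \<alpha>) h \<in> borel_measurable lebesgue" for \<alpha> :: "'d \<Rightarrow> bool"
    using grid_sets countable_grid by (intro maxfn_measurable)
  have "(\<integral>\<^sup>+x. (grid_max h x)^2 * ennreal (inverse (w x)) \<partial>lebesgue)
      \<le> (\<integral>\<^sup>+x. (\<Sum>\<alpha>\<in>UNIV. (maxfn lebesgue (grid \<alpha>) h x)^2 * ennreal (inverse (w x))) \<partial>lebesgue)"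
  proof (rule nn_integral_mono)
    fix x
    have "grid_max h x \<in> (\<lambda>\<alpha>. maxfn lebesgue (grid \<alpha>) h x) ` UNIV"
      unfolding grid_max_def by (subst cSup_eq_Max) (auto intro!: Max_in)
    then obtain \<alpha> where "grid_max h x = maxfn lebesgue (grid \<alpha>) h x" by auto
    then show "(grid_max h x)^2 * ennreal (inverse (w x))
        \<le> (\<Sum>\<alpha>\<in>UNIV. (maxfn lebesgue (grid \<alpha>) h x)^2 * ennreal (inverse (w x)))"
      using member_le_sum[of \<alpha> UNIV "\<lambda>\<alpha>. (maxfn lebesgue (grid \<alpha>) h x)^2 * ennreal (inverse (w x))"] by simp
  qed
  also have "\<dots> = (\<Sum>\<alpha>\<in>UNIV. \<integral>\<^sup>+x. (maxfn lebesgue (grid \<alpha>) h x)^2 * ennreal (inverse (w x)) \<partial>lebesgue)"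
    by (intro nn_integral_sum) auto
  also have "\<dots> \<le> (\<Sum>\<alpha>\<in>(UNIV :: ('d \<Rightarrow> bool) set). ?R)" by (intro sum_mono one)
  also have "\<dots> = of_nat CARD('d \<Rightarrow> bool) * ?R" by simp
  finally show ?thesis .
qed

section \<open>Rubio de Francia majorants\<close>

lemma square_add_le: "(a + b)^2 \<le> 2 * a^2 + 2 * (b::ennreal)^2"
proof -
  have "(a + b)^2 = a^2 + b^2 + 2 * a * b"
    unfolding power2_eq_square mult_2 distrib_left distrib_right by (simp only: ac_simps)
  also have "\<dots> \<le> a^2 + b^2 + (a^2 + b^2)"
    by (intro add_left_mono sum_of_squares_ge_ennreal)
  finally show ?thesis by (simp add: mult_2 ac_simps)
qed

lemma grid_max_mono: "(\<And>x. f x \<le> g x) \<Longrightarrow> grid_max f x \<le> grid_max g x"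
  unfolding grid_max_def maxfn_def mean_def
  by (intro SUP_mono' mult_right_mono divide_right_mono_ennreal nn_integral_mono) auto

text \<open>
  The function \<open>u\<close> is the increasing limit of the iterates of \<open>v \<mapsto> h + M v / (2 A)\<close> started at 0. By
  \<open>(a + b)\<^sup>2 \<le> 2 a\<^sup>2 + 2 b\<^sup>2\<close> the squared norms satisfy \<open>\<parallel>v\<^sub>n\<^sub>+\<^sub>1\<parallel>\<^sup>2 \<le> 2 \<parallel>h\<parallel>\<^sup>2 + \<parallel>v\<^sub>n\<parallel>\<^sup>2 / 2\<close> and hence stay below \<open>4 \<parallel>h\<parallel>\<^sup>2\<close>.
  That the limit satisfies \<open>M u \<le> 2 A u\<close> follows by monotone convergence of the means.
\<close>

lemma rubio_de_francia:
  fixes s :: "real ^ 'd \<Rightarrow> ennreal"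
  assumes [measurable]: "s \<in> borel_measurable lebesgue" "h \<in> borel_measurable lebesgue" and A: "0 < A"
    and bound: "\<And>g. g \<in> borel_measurable lebesgue \<Longrightarrow>
      (\<integral>\<^sup>+x. (grid_max g x)^2 * s x \<partial>lebesgue) \<le> (ennreal A)^2 * (\<integral>\<^sup>+x. (g x)^2 * s x \<partial>lebesgue)"
  obtains u where "u \<in> borel_measurable lebesgue" "\<And>x. h x \<le> u x" "\<And>x. grid_max u x \<le> ennreal (2 * A) * u x"
    "(\<integral>\<^sup>+x. (u x)^2 * s x \<partial>lebesgue) \<le> 4 * (\<integral>\<^sup>+x. (h x)^2 * s x \<partial>lebesgue)"
proof -
  define c where "c = inverse (ennreal (2 * A))"
  have cA: "c * ennreal (2 * A) = 1" using A by (simp add: c_def inverse_ennreal flip: ennreal_mult)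
  have c2: "2 * (c * ennreal A)^2 * 4 = 2"
  proof -
    have "c * ennreal A = ennreal (1 / 2)"
      using A by (simp add: c_def inverse_ennreal flip: ennreal_mult)
    then have "(c * ennreal A)^2 = ennreal ((1 / 2)^2)" by (metis ennreal_power zero_le_divide_1_iff zero_le_numeral)
    also have "(1 / 2)^2 = (1 / 4 :: real)" by (simp add: power2_eq_square)
    finally have "(c * ennreal A)^2 = ennreal (1 / 4)" .
    moreover have "2 * ennreal (1 / 4) * 4 = 2"
      using ennreal_mult[of "1/2" 4] ennreal_mult[of 2 "1/4"] by simp
    ultimately show ?thesis by simp
  qed
  define v where "v n = ((\<lambda>u x. h x + c * grid_max u x) ^^ n) (\<lambda>x. 0)" for n
  have v0: "v 0 = (\<lambda>x. 0)" and vSuc: "v (Suc n) = (\<lambda>x. h x + c * grid_max (v n) x)" for n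
    by (simp_all add: v_def)
  have [measurable]: "v n \<in> borel_measurable lebesgue" for n
    by (cases n) (simp_all add: v0 vSuc)
  have "v n x \<le> v (Suc n) x" for n x
  proof (induction n arbitrary: x)
    case (Suc n)
    show ?case unfolding vSuc[of n] vSuc[of "Suc n"]
      by (intro add_left_mono mult_left_mono grid_max_mono Suc[unfolded vSuc]) auto
  qed (simp add: v0)
  then have inc: "incseq v" by (intro incseq_SucI le_funI)
  let ?H = "\<integral>\<^sup>+x. (h x)^2 * s x \<partial>lebesgue"
  have norm: "(\<integral>\<^sup>+x. (v n x)^2 * s x \<partial>lebesgue) \<le> 4 * ?H" for n
  proof (induction n)
    case (Suc n)
    have "(\<integral>\<^sup>+x. (v (Suc n) x)^2 * s x \<partial>lebesgue)
        \<le> (\<integral>\<^sup>+x. 2 * ((h x)^2 * s x) + 2 * c^2 * ((grid_max (v n) x)^2 * s x) \<partial>lebesgue)"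
    proof (rule nn_integral_mono)
      fix x
      show "(v (Suc n) x)^2 * s x \<le> 2 * ((h x)^2 * s x) + 2 * c^2 * ((grid_max (v n) x)^2 * s x)"
        using mult_right_mono[OF square_add_le[of "h x" "c * grid_max (v n) x"] zero_le[of "s x"]]
        unfolding vSuc power_mult_distrib distrib_right mult.assoc .
    qed
    also have "\<dots> = 2 * ?H + 2 * c^2 * (\<integral>\<^sup>+x. (grid_max (v n) x)^2 * s x \<partial>lebesgue)"
      by (simp add: nn_integral_add nn_integral_cmult)
    also have "\<dots> \<le> 2 * ?H + 2 * c^2 * ((ennreal A)^2 * (4 * ?H))"
      by (intro add_left_mono mult_left_mono order_trans[OF bound] Suc) auto
    also have "2 * c^2 * ((ennreal A)^2 * (4 * ?H)) = (2 * (c * ennreal A)^2) * (4 * ?H)"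
      by (simp add: power_mult_distrib mult_ac)
    also have "\<dots> = 2 * ?H"
      unfolding mult.assoc[symmetric] c2 ..
    also have "2 * ?H + 2 * ?H = 4 * ?H" by (simp flip: distrib_right)
    finally show ?case .
  qed (simp add: v0)
  define u where "u x = (SUP n. v n x)" for x
  have [measurable]: "u \<in> borel_measurable lebesgue" unfolding u_def[abs_def] by measurable
  have vu: "v n x \<le> u x" for n x unfolding u_def by (rule SUP_upper) auto
  show thesis
  proof (rule that[of u])
    show "h x \<le> u x" for x
      using vu[of "Suc 0" x] by (auto simp: vSuc intro: order_trans[OF add_increasing2])
    show "grid_max u x \<le> ennreal (2 * A) * u x" for x
      unfolding grid_max_def maxfn_def
    proof (intro SUP_least)
      fix \<alpha> :: "'d \<Rightarrow> bool" and Q assume Q: "Q \<in> grid \<alpha>"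
      then have [measurable]: "Q \<in> sets lebesgue" using grid_sets by auto
      show "mean lebesgue u Q * indicator Q x \<le> ennreal (2 * A) * u x"
      proof (cases "x \<in> Q")
        case True
        have "(\<integral>\<^sup>+y\<in>Q. u y \<partial>lebesgue) = (SUP n. \<integral>\<^sup>+y\<in>Q. v n y \<partial>lebesgue)"
          unfolding u_def SUP_mult_right_ennreal
          using inc by (intro nn_integral_monotone_convergence_SUP)
            (auto simp: incseq_def le_fun_def intro!: mult_right_mono)
        then have "mean lebesgue u Q = (SUP n. mean lebesgue (v n) Q)"
          unfolding mean_def by (simp add: SUP_divide_ennreal)
        also have "\<dots> \<le> ennreal (2 * A) * u x"
        proof (rule SUP_least)
          fix n
          have "mean lebesgue (v n) Q \<le> grid_max (v n) x" by (rule mean_le_grid_max[OF Q True])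
          also have "\<dots> = ennreal (2 * A) * (c * grid_max (v n) x)"
            unfolding mult.assoc[symmetric] using cA by (simp add: mult.commute)
          also have "\<dots> \<le> ennreal (2 * A) * v (Suc n) x"
            unfolding vSuc by (intro mult_left_mono) auto
          also have "\<dots> \<le> ennreal (2 * A) * u x" by (intro mult_left_mono vu) auto
          finally show "mean lebesgue (v n) Q \<le> ennreal (2 * A) * u x" .
        qed
        finally show ?thesis using True by simp
      qed simp
    qed
    have "(u x)^2 * s x = (SUP n. (v n x)^2 * s x)" for x
    proof -
      have "incseq (\<lambda>n. v n x)" using inc by (auto simp: incseq_def le_fun_def)
      then show ?thesis unfolding u_def by (simp add: SUP_power2_ennreal SUP_mult_right_ennreal)
    qed
    then have "(\<integral>\<^sup>+x. (u x)^2 * s x \<partial>lebesgue) = (SUP n. \<integral>\<^sup>+x. (v n x)^2 * s x \<partial>lebesgue)"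
      using inc by (simp, intro nn_integral_monotone_convergence_SUP)
        (auto simp: incseq_def le_fun_def intro!: mult_right_mono power_mono)
    also have "\<dots> \<le> 4 * ?H" by (intro SUP_least norm)
    finally show "(\<integral>\<^sup>+x. (u x)^2 * s x \<partial>lebesgue) \<le> 4 * ?H" .
  qed measurable
qed

lemma le_mult_ess_inf:
  assumes "0 < B" and "AE x in lebesgue. x \<in> I \<longrightarrow> t \<le> ennreal B * ennreal (w x)"
  shows "t \<le> ennreal B * ess_inf_on I w"
proof -
  have "t = ennreal B * (t / ennreal B)"
    using assms(1) by (simp add: ennreal_times_divide mult.commute[of _ t] ennreal_mult_divide_eq)
  also have "\<dots> \<le> ennreal B * ess_inf_on I w"
  proof (intro mult_left_mono)
    have "AE x in lebesgue. x \<in> I \<longrightarrow> t / ennreal B \<le> ennreal (w x)"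
      using assms(2)
    proof eventually_elim
      case (elim x)
      show ?case
      proof
        assume "x \<in> I"
        then have "t / ennreal B \<le> ennreal B * ennreal (w x) / ennreal B"
          using elim by (intro divide_right_mono_ennreal) auto
        then show "t / ennreal B \<le> ennreal (w x)"
          using assms(1) by (simp add: mult.commute[of "ennreal B"] ennreal_mult_divide_eq)
      qed
    qed
    then show "t / ennreal B \<le> ess_inf_on I w" unfolding ess_inf_on_def by (intro Sup_upper) simp
  qed auto
  finally show ?thesis .
qed

text \<open>
  The iteration is applied to \<open>1_E w\<close> with \<open>A = 4 \<cdot> 2^d [w]\<close>, which dominates the norm \<open>4 \<cdot> 2^(d/2) [w]\<close> of the grid
  maximal operator. The mean over a cube is at most \<open>6^d\<close> times the mean over the enclosing cell, which
  yields the A1 constant \<open>2 A 6^d\<close>. Since \<open>E\<close> has positive mass, the A1 inequality on large cubes makes the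
  majorant positive everywhere; since it is finite almost everywhere, the same inequality makes it locally
  integrable.
\<close>

lemma A1_majorant:
  fixes w :: "real ^ 'd \<Rightarrow> real"
  assumes w: "A2 w" and E [measurable]: "E \<in> sets lebesgue" and "bounded E"
    and pos: "0 < (\<integral>\<^sup>+x\<in>E. ennreal (w x) \<partial>lebesgue)"
  obtains v where "weight v"
    "A1_bound v (ennreal (8 * real CARD('d \<Rightarrow> bool) * 6 ^ CARD('d) * enn2real (A2_const w)))"
    "AE x in lebesgue. x \<in> E \<longrightarrow> w x \<le> v x"
    "(\<integral>\<^sup>+x. (ennreal (v x))^2 * ennreal (inverse (w x)) \<partial>lebesgue) \<le> 4 * (\<integral>\<^sup>+x\<in>E. ennreal (w x) \<partial>lebesgue)"
proof -
  define N where "N = enn2real (A2_const w)"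
  define k where "k = real CARD('d \<Rightarrow> bool)"
  have k: "1 \<le> k" unfolding k_def by (simp add: Suc_le_eq)
  have N: "A2_const w = ennreal N" "0 < N"
    using w A2_const_pos[OF w] unfolding N_def A2_def by (auto simp: enn2real_positive_iff)
  \<comment> \<open>The square of the operator norm is at most \<open>16 k N\<^sup>2\<close>, and \<open>16 k N\<^sup>2 \<le> A\<^sup>2\<close> because \<open>k \<ge> 1\<close>.\<close>
  define A where "A = 4 * k * N"
  have A: "0 < A" using N k by (simp add: A_def)
  have W: "weight w" using w by (simp add: A2_def)
  then have [measurable]: "w \<in> borel_measurable lebesgue" and wpos: "AE x in lebesgue. 0 < w x"
    by (simp_all add: weight_def)
  define h where "h x = ennreal (w x) * indicator E x" for x
  have [measurable]: "h \<in> borel_measurable lebesgue" unfolding h_def[abs_def] by measurable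
  have hint: "(\<integral>\<^sup>+x. (h x)^2 * ennreal (inverse (w x)) \<partial>lebesgue) = (\<integral>\<^sup>+x\<in>E. ennreal (w x) \<partial>lebesgue)"
    using wpos by (intro nn_integral_cong_AE)
      (auto elim!: eventually_mono simp: h_def indicator_def power2_eq_square simp flip: ennreal_mult)
  have bound: "(\<integral>\<^sup>+x. (grid_max g x)^2 * ennreal (inverse (w x)) \<partial>lebesgue)
      \<le> (ennreal A)^2 * (\<integral>\<^sup>+x. (g x)^2 * ennreal (inverse (w x)) \<partial>lebesgue)"
    if [measurable]: "g \<in> borel_measurable lebesgue" for g
  proof -
    have "of_nat CARD('d \<Rightarrow> bool) * (16 * (A2_const w)^2) = ennreal (k * (16 * N^2))"
      using N by (simp add: k_def ennreal_mult ennreal_of_nat_eq_real_of_nat ennreal_power)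
    also have "\<dots> \<le> ennreal (A^2)"
      using k N(2) unfolding A_def power_mult_distrib
      by (intro ennreal_leI) (auto simp: power2_eq_square mult_ac)
    also have "\<dots> = (ennreal A)^2" using A by (simp add: ennreal_power)
    finally have "of_nat CARD('d \<Rightarrow> bool) * (16 * (A2_const w)^2) \<le> (ennreal A)^2" .
    then show ?thesis
      using grid_max_A2_bound[OF w that] unfolding mult.assoc[symmetric] by (meson mult_right_mono order_trans zero_le)
  qed
  obtain u where [measurable]: "u \<in> borel_measurable lebesgue" and hu: "\<And>x. h x \<le> u x"
    and Mu: "\<And>x. grid_max u x \<le> ennreal (2 * A) * u x"
    and u2: "(\<integral>\<^sup>+x. (u x)^2 * ennreal (inverse (w x)) \<partial>lebesgue) \<le> 4 * (\<integral>\<^sup>+x\<in>E. ennreal (w x) \<partial>lebesgue)"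
    using rubio_de_francia[of "\<lambda>x. ennreal (inverse (w x))" h A] A bound hint by auto
  define B where "B = 8 * real CARD('d \<Rightarrow> bool) * 6 ^ CARD('d) * enn2real (A2_const w)"
  have B: "B = 2 * A * 6 ^ CARD('d)" "0 < B" using N k by (simp_all add: B_def A_def k_def flip: N_def)
  have avg: "(\<integral>\<^sup>+x\<in>I. u x \<partial>lebesgue) / emeasure lebesgue I \<le> ennreal B * u x" if I: "I \<in> cubes" and x: "x \<in> I" for I x
  proof -
    obtain \<alpha> Q where Q: "Q \<in> grid \<alpha>" "I \<subseteq> Q" "emeasure lebesgue Q \<le> 6 ^ CARD('d) * emeasure lebesgue I"
      using cube_subset_grid[OF I] .
    have Q': "0 < emeasure lebesgue Q" "emeasure lebesgue Q < \<infinity>" using grid_subset_cube[OF Q(1)] by metis+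
    have "(\<integral>\<^sup>+x\<in>I. u x \<partial>lebesgue) \<le> (\<integral>\<^sup>+x\<in>Q. u x \<partial>lebesgue)"
      using Q(2) by (intro nn_integral_mono) (auto simp: indicator_def)
    also have "\<dots> = mean lebesgue u Q * emeasure lebesgue Q"
      using Q' by (simp add: mean_def ennreal_divide_times less_top)
    also have "\<dots> \<le> (ennreal (2 * A) * u x) * (6 ^ CARD('d) * emeasure lebesgue I)"
      using Q x Mu[of x] mean_le_grid_max[OF Q(1), of x u] by (intro mult_mono) auto
    also have "\<dots> = ennreal B * u x * emeasure lebesgue I"
      using A by (simp add: B ennreal_mult mult_ac flip: ennreal_power)
    finally have "(\<integral>\<^sup>+x\<in>I. u x \<partial>lebesgue) / emeasure lebesgue I \<le> ennreal B * u x * emeasure lebesgue I / emeasure lebesgue I"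
      by (rule divide_right_mono_ennreal)
    then show ?thesis using cubeD(2,3)[OF I] by (simp add: ennreal_mult_divide_eq)
  qed
  have "4 * (\<integral>\<^sup>+x\<in>E. ennreal (w x) \<partial>lebesgue) < \<infinity>"
  proof -
    obtain I where I: "I \<in> cubes" "E \<subseteq> I" using bounded_subset_cube[OF \<open>bounded E\<close>] .
    have "(\<integral>\<^sup>+x\<in>E. ennreal (w x) \<partial>lebesgue) \<le> (\<integral>\<^sup>+x\<in>I. ennreal (w x) \<partial>lebesgue)"
      using I(2) by (intro nn_integral_mono) (auto simp: indicator_def)
    then show ?thesis using weight_integral_finite[OF W I(1)] by (auto simp: ennreal_mult_less_top)
  qed
  with u2 have "(\<integral>\<^sup>+x. (u x)^2 * ennreal (inverse (w x)) \<partial>lebesgue) \<noteq> \<infinity>" by auto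
  then have "AE x in lebesgue. (u x)^2 * ennreal (inverse (w x)) \<noteq> \<infinity>"
    by (intro nn_integral_PInf_AE) auto
  with wpos have ufin: "AE x in lebesgue. u x < \<infinity>"
    by eventually_elim (auto simp: less_top[symmetric] power2_eq_square ennreal_top_mult)
  define v where "v x = enn2real (u x)" for x
  have [measurable]: "v \<in> borel_measurable lebesgue" unfolding v_def[abs_def] by measurable
  have vu: "AE x in lebesgue. ennreal (v x) = u x"
    using ufin by eventually_elim (simp add: v_def)
  have upos: "0 < u x" for x
  proof -
    have "bounded (insert x E)" using \<open>bounded E\<close> by simp
    then obtain I where I: "I \<in> cubes" "insert x E \<subseteq> I" using bounded_subset_cube by blast
    have "(\<integral>\<^sup>+x\<in>E. ennreal (w x) \<partial>lebesgue) \<le> (\<integral>\<^sup>+x\<in>I. u x \<partial>lebesgue)"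
      using I(2) hu by (intro nn_integral_mono) (force simp: indicator_def h_def)
    then have "0 < (\<integral>\<^sup>+x\<in>I. u x \<partial>lebesgue) / emeasure lebesgue I"
      using pos cubeD(3)[OF I(1)] by (auto simp: ennreal_zero_less_divide)
    also have "\<dots> \<le> ennreal B * u x" using I by (intro avg) auto
    finally show ?thesis by (auto simp: zero_less_iff_neq_zero)
  qed
  have vint: "(\<integral>\<^sup>+x\<in>I. ennreal (v x) \<partial>lebesgue) = (\<integral>\<^sup>+x\<in>I. u x \<partial>lebesgue)" for I
    using vu by (intro nn_integral_cong_AE) (auto elim: eventually_mono)
  show thesis
  proof (rule that[of v, folded B_def])
    show "weight v" unfolding weight_def
    proof (intro conjI allI impI)
      show "AE x in lebesgue. 0 < v x"
        using ufin by eventually_elim (simp add: v_def enn2real_positive_iff upos)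
      fix K :: "(real ^ 'd) set" assume K: "compact K"
      then obtain I where I: "I \<in> cubes" "K \<subseteq> I" using bounded_subset_cube compact_imp_bounded by blast
      have "\<exists>x. x \<in> I \<and> u x < \<infinity>"
      proof (rule ccontr)
        assume "\<not> ?thesis"
        then have "x \<notin> I" if "u x < \<infinity>" for x using that by blast
        then have "AE x in lebesgue. x \<notin> I" by (rule eventually_mono[OF ufin])
        then show False
          using cubeD(1,2)[OF I(1)] AE_iff_null_sets[of I lebesgue] by auto
      qed
      then obtain x where x: "x \<in> I" "u x < \<infinity>" by blast
      have "(\<integral>\<^sup>+x\<in>I. u x \<partial>lebesgue) / emeasure lebesgue I < \<infinity>"
        by (rule le_less_trans[OF avg[OF I(1) x(1)]]) (use x(2) in \<open>simp add: ennreal_mult_less_top\<close>)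
      then have "(\<integral>\<^sup>+x\<in>I. u x \<partial>lebesgue) < \<infinity>"
        using cubeD(3)[OF I(1)] by (auto simp: less_top[symmetric] ennreal_divide_eq_top_iff)
      moreover have "(\<integral>\<^sup>+x. ennreal (norm (indicator K x *\<^sub>R v x)) \<partial>lebesgue) \<le> (\<integral>\<^sup>+x\<in>I. u x \<partial>lebesgue)"
        unfolding vint[symmetric] using I(2) by (intro nn_integral_mono) (auto simp: indicator_def v_def)
      ultimately have fin: "(\<integral>\<^sup>+x. ennreal (norm (indicator K x *\<^sub>R v x)) \<partial>lebesgue) < \<infinity>"
        by (rule le_less_trans[rotated])
      have [measurable]: "K \<in> sets lebesgue" using K by (simp add: borel_compact)
      show "set_integrable lebesgue K v"
        unfolding set_integrable_def by (rule integrableI_bounded[OF _ fin]) measurable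
    qed measurable
    show "A1_bound v (ennreal B)"
      unfolding A1_bound_def
    proof
      fix I :: "(real ^ 'd) set" assume I: "I \<in> cubes"
      show "average v I \<le> ennreal B * ess_inf_on I v"
        using vu B(2) avg[OF I] unfolding average_def vint
        by (intro le_mult_ess_inf) (auto elim!: eventually_mono)
    qed
    show "AE x in lebesgue. x \<in> E \<longrightarrow> w x \<le> v x"
      using vu wpos
    proof eventually_elim
      case (elim x)
      show ?case
      proof
        assume "x \<in> E"
        then have "ennreal (w x) \<le> ennreal (v x)" using hu[of x] elim(1) by (simp add: h_def)
        moreover have "0 \<le> v x" by (simp add: v_def)
        ultimately show "w x \<le> v x" by (simp add: ennreal_le_iff)
      qed
    qed
    show "(\<integral>\<^sup>+x. (ennreal (v x))^2 * ennreal (inverse (w x)) \<partial>lebesgue) \<le> 4 * (\<integral>\<^sup>+x\<in>E. ennreal (w x) \<partial>lebesgue)"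
    proof -
      have "(\<integral>\<^sup>+x. (ennreal (v x))^2 * ennreal (inverse (w x)) \<partial>lebesgue) = (\<integral>\<^sup>+x. (u x)^2 * ennreal (inverse (w x)) \<partial>lebesgue)"
        using vu by (intro nn_integral_cong_AE) (auto elim: eventually_mono)
      then show ?thesis using u2 by simp
    qed
  qed
qed

section \<open>Prescribing the A1 constant exactly\<close>

lemma ess_inf_times_le:
  assumes "u \<in> borel_measurable lebesgue" "J \<in> sets lebesgue" "J \<subseteq> I"
  shows "ess_inf_on I u * emeasure lebesgue J \<le> (\<integral>\<^sup>+x\<in>J. ennreal (u x) \<partial>lebesgue)"
proof -
  have "z * emeasure lebesgue J \<le> (\<integral>\<^sup>+x\<in>J. ennreal (u x) \<partial>lebesgue)"
    if "AE x in lebesgue. x \<in> I \<longrightarrow> z \<le> ennreal (u x)" for z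
  proof -
    have "z * emeasure lebesgue J = (\<integral>\<^sup>+x\<in>J. z \<partial>lebesgue)"
      using assms(2) by (simp add: nn_integral_cmult_indicator)
    also have "\<dots> \<le> (\<integral>\<^sup>+x\<in>J. ennreal (u x) \<partial>lebesgue)"
      using that assms(3) by (intro nn_integral_mono_AE) (auto elim!: eventually_mono simp: indicator_def)
    finally show ?thesis .
  qed
  moreover have "Sup Z * c = (SUP z\<in>Z. z * c)" for Z :: "ennreal set" and c
    using SUP_mult_right_ennreal[of "\<lambda>z. z" Z c] by simp
  ultimately show ?thesis unfolding ess_inf_on_def by (auto intro!: SUP_least)
qed

text \<open>
  Replacing a weight by a comparable one changes each side of the A1 inequality by at most the comparison
  factors. This gives the continuity of the A1 constant in \<open>A1_exact_constant\<close>.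
\<close>

lemma A1_bound_compare:
  assumes ab: "0 < a" "0 < b"
    and u': "AE x in lebesgue. u' x \<le> a * u x" and u: "AE x in lebesgue. u x \<le> b * u' x"
    and [measurable]: "u \<in> borel_measurable lebesgue"
    and B: "A1_bound u B"
  shows "A1_bound u' (ennreal (a * b) * B)"
  unfolding A1_bound_def
proof
  fix I :: "(real ^ 'a) set" assume I: "I \<in> cubes"
  then have [measurable]: "I \<in> sets lebesgue" by (rule cubeD)
  have "(\<integral>\<^sup>+x\<in>I. ennreal (u' x) \<partial>lebesgue) \<le> (\<integral>\<^sup>+x. ennreal a * (ennreal (u x) * indicator I x) \<partial>lebesgue)"
    using u' ab by (intro nn_integral_mono_AE)
      (auto elim!: eventually_mono simp: indicator_def ennreal_mult'[symmetric] intro!: ennreal_leI)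
  also have "\<dots> = ennreal a * (\<integral>\<^sup>+x\<in>I. ennreal (u x) \<partial>lebesgue)"
    by (intro nn_integral_cmult) measurable
  finally have "average u' I \<le> ennreal a * average u I"
    unfolding average_def ennreal_times_divide by (rule divide_right_mono_ennreal)
  also have "\<dots> \<le> ennreal a * (B * ess_inf_on I u)"
    using B I by (intro mult_left_mono) (auto simp: A1_bound_def)
  also have "\<dots> \<le> ennreal a * (B * (ennreal b * ess_inf_on I u'))"
  proof (intro mult_left_mono)
    show "ess_inf_on I u \<le> ennreal b * ess_inf_on I u'"
      unfolding ess_inf_on_def[of I u]
    proof (rule Sup_least, elim CollectE)
      fix z assume z: "AE x in lebesgue. x \<in> I \<longrightarrow> z \<le> ennreal (u x)"
      have "AE x in lebesgue. x \<in> I \<longrightarrow> z \<le> ennreal b * ennreal (u' x)"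
        using z u
      proof eventually_elim
        case (elim x)
        have "ennreal (u x) \<le> ennreal b * ennreal (u' x)"
          using elim(2) ab by (simp add: ennreal_mult'[symmetric] ennreal_leI)
        then show ?case using elim(1) by auto
      qed
      then show "z \<le> ennreal b * ess_inf_on I u'" by (intro le_mult_ess_inf ab)
    qed
  qed auto
  also have "\<dots> = ennreal (a * b) * B * ess_inf_on I u'"
    using ab by (simp add: ennreal_mult mult_ac)
  finally show "average u' I \<le> ennreal (a * b) * B * ess_inf_on I u'" .
qed

lemma A1_const_compare:
  assumes ab: "0 < a" "0 < b"
    and "AE x in lebesgue. u' x \<le> a * u x" "AE x in lebesgue. u x \<le> b * u' x"
    and "u \<in> borel_measurable lebesgue"
  shows "A1_const u' \<le> ennreal (a * b) * A1_const u"
proof -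
  define c where "c = ennreal (a * b)"
  have c: "c \<noteq> 0" "c \<noteq> top" using ab by (auto simp: c_def not_le)
  have "A1_const u' / c \<le> A1_const u"
    unfolding A1_const_def[of u]
  proof (rule Inf_greatest, elim CollectE)
    fix B assume "A1_bound u B"
    then have "A1_const u' \<le> c * B"
      unfolding A1_const_def c_def by (intro Inf_lower CollectI A1_bound_compare[OF assms])
    then have "A1_const u' / c \<le> B * c / c"
      unfolding mult.commute[of c] by (rule divide_right_mono_ennreal)
    then show "A1_const u' / c \<le> B" using c by (simp add: ennreal_mult_divide_eq)
  qed
  then have "A1_const u' / c * c \<le> A1_const u * c"
    by (rule mult_right_mono) auto
  moreover have "A1_const u' / c * c = A1_const u'"
    using c by (simp add: ennreal_divide_times less_top)
  ultimately show ?thesis unfolding c_def[symmetric] by (simp only: mult.commute)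
qed

text \<open>
  Let \<open>I\<close> be the cube of twice the side length that contains \<open>Q\<close>, and \<open>R\<close> the opposite corner of \<open>I\<close>, which does
  not meet \<open>Q\<close>. Off \<open>Q\<close> the spiked weight equals \<open>v\<close>, and the A1 bound for \<open>v\<close> shows that its infimum over \<open>I\<close> is at
  most \<open>2^d N\<close> times the mean of \<open>v\<close> over \<open>Q\<close>; its mean over \<open>I\<close> is at least \<open>2^-d\<close> times the height times that mean.
  The height \<open>4^d N\<^sup>2\<close> makes the ratio at least \<open>N\<close>, independently of the side length \<open>l\<close>.
\<close>

lemma spike_lower_bound:
  fixes v :: "real ^ 'd \<Rightarrow> real" and l N B
  defines "Q \<equiv> box 0 (\<chi> i. l)"
  assumes v: "weight v" and N: "A1_bound v (ennreal N)" "0 < N" and l: "0 < l"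
    and B: "A1_bound (\<lambda>x. v x * (1 + 4 ^ CARD('d) * N^2 * indicator Q x)) B"
  shows "ennreal N \<le> B"
proof -
  define S where "S = 4 ^ CARD('d) * N^2"
  define u where "u x = v x * (1 + S * indicator Q x)" for x
  have S: "0 < S" using N by (simp add: S_def)
  have [measurable]: "v \<in> borel_measurable lebesgue" and v0: "AE x in lebesgue. 0 < v x"
    using v by (auto simp: weight_def)
  have [measurable]: "Q \<in> sets lebesgue" unfolding Q_def by simp
  have [measurable]: "u \<in> borel_measurable lebesgue" unfolding u_def[abs_def] by measurable
  define I :: "(real ^ 'd) set" where "I = cbox 0 (0 + (\<chi> i. 2 * l))"
  define R :: "(real ^ 'd) set" where "R = cbox (\<chi> i. l) ((\<chi> i. l) + (\<chi> i. l))"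
  have "2 * l > 0" using l by simp
  then have IR: "I \<in> cubes" "R \<in> cubes" unfolding I_def R_def cubes_def using l by blast+
  have sub: "Q \<subseteq> I"
  proof
    fix x assume "x \<in> Q"
    then have "0 < x $ i" "x $ i < l" for i by (simp_all add: Q_def mem_box_cart)
    then have "0 \<le> x $ i" "x $ i \<le> 2 * l" for i using l by (smt (verit))+
    then show "x \<in> I" by (simp add: I_def mem_box_cart)
  qed
  have sub': "R \<subseteq> I"
  proof
    fix x assume "x \<in> R"
    then have "l \<le> x $ i" "x $ i \<le> 2 * l" for i by (simp_all add: R_def mem_box_cart)
    then have "0 \<le> x $ i" "x $ i \<le> 2 * l" for i using l by (smt (verit))+
    then show "x \<in> I" by (simp add: I_def mem_box_cart)
  qed
  have disj: "Q \<inter> R = {}"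
    by (auto simp: Q_def R_def mem_box_cart not_less[symmetric])
  define q where "q = ennreal (l ^ CARD('d))"
  have em: "emeasure lebesgue Q = q" "emeasure lebesgue R = q" "emeasure lebesgue I = 2 ^ CARD('d) * q"
    using l emeasure_cube(2)[of l "0 :: real^'d"] emeasure_cube(1)[of l "(\<chi> i. l) :: real^'d"]
      emeasure_cube(1)[of "2 * l" "0 :: real^'d"]
    by (simp_all add: Q_def R_def I_def q_def power_mult_distrib ennreal_mult flip: ennreal_power)
  have q: "0 < q" using l by (simp add: q_def)
  define m where "m = (\<integral>\<^sup>+x\<in>Q. ennreal (v x) \<partial>lebesgue)"
  have m: "0 < m" unfolding m_def using v0 em q by (intro emeasure_density_pos) auto
  have "m \<le> (\<integral>\<^sup>+x\<in>I. ennreal (v x) \<partial>lebesgue)"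
    unfolding m_def using sub by (intro nn_integral_mono) (auto simp: indicator_def)
  then have m_fin: "m < \<infinity>" using weight_integral_finite[OF v IR(1)] by (rule le_less_trans)
  have "ess_inf_on I u * q \<le> (\<integral>\<^sup>+x\<in>R. ennreal (u x) \<partial>lebesgue)"
    using ess_inf_times_le[of u R I] sub' IR cubeD(1) em by auto
  also have "\<dots> = (\<integral>\<^sup>+x\<in>R. ennreal (v x) \<partial>lebesgue)"
    using disj by (intro nn_integral_cong) (auto simp: u_def indicator_def)
  also have "\<dots> \<le> (\<integral>\<^sup>+x\<in>I. ennreal (v x) \<partial>lebesgue)"
    using sub' by (intro nn_integral_mono) (auto simp: indicator_def)
  also have "\<dots> = average v I * (2 ^ CARD('d) * q)"
    using average_mult[OF IR(1), of v] em by simp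
  also have "\<dots> \<le> (ennreal N * ess_inf_on I v) * (2 ^ CARD('d) * q)"
    using N(1) IR by (intro mult_right_mono) (auto simp: A1_bound_def)
  also have "\<dots> = ennreal N * 2 ^ CARD('d) * (ess_inf_on I v * q)" by (simp add: mult_ac)
  also have "\<dots> \<le> ennreal N * 2 ^ CARD('d) * m"
    using ess_inf_times_le[of v Q I] sub em unfolding m_def by (intro mult_left_mono) auto
  finally have ess: "ess_inf_on I u * q \<le> ennreal N * 2 ^ CARD('d) * m" .
  have "ennreal S * m = (\<integral>\<^sup>+x. ennreal S * (ennreal (v x) * indicator Q x) \<partial>lebesgue)"
    unfolding m_def by (intro nn_integral_cmult[symmetric]) measurable
  also have "\<dots> \<le> (\<integral>\<^sup>+x\<in>I. ennreal (u x) \<partial>lebesgue)"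
    using v0 sub S by (intro nn_integral_mono_AE)
      (auto elim!: eventually_mono simp: u_def indicator_def ennreal_mult'[symmetric] algebra_simps intro!: ennreal_leI)
  also have "\<dots> = average u I * (2 ^ CARD('d) * q)"
    using average_mult[OF IR(1), of u] em by simp
  also have "\<dots> \<le> (B * ess_inf_on I u) * (2 ^ CARD('d) * q)"
    using B IR unfolding S_def[symmetric] u_def[symmetric] by (intro mult_right_mono) (auto simp: A1_bound_def)
  also have "\<dots> = B * 2 ^ CARD('d) * (ess_inf_on I u * q)" by (simp add: mult_ac)
  also have "\<dots> \<le> B * 2 ^ CARD('d) * (ennreal N * 2 ^ CARD('d) * m)"
    by (intro mult_left_mono ess) auto
  finally have *: "ennreal S * m \<le> B * 2 ^ CARD('d) * (ennreal N * 2 ^ CARD('d) * m)" .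
  show ?thesis
  proof (cases B)
    case (real b)
    obtain m' where m': "m = ennreal m'" "0 < m'" using m m_fin by (cases m) auto
    have "B * 2 ^ CARD('d) * (ennreal N * 2 ^ CARD('d) * m) = ennreal (b * 2 ^ CARD('d) * (N * 2 ^ CARD('d) * m'))"
      using real N m' by (simp add: ennreal_mult flip: ennreal_power)
    then have "ennreal (S * m') \<le> ennreal (b * 2 ^ CARD('d) * (N * 2 ^ CARD('d) * m'))"
      using * S m' by (simp add: ennreal_mult)
    then have "S * m' \<le> b * 2 ^ CARD('d) * (N * 2 ^ CARD('d) * m')"
      using real N m' by (simp add: ennreal_le_iff)
    also have "\<dots> = b * (4 ^ CARD('d) * N * m')"
      by (simp add: mult_ac flip: power_mult_distrib)
    finally have "N * (4 ^ CARD('d) * N * m') \<le> b * (4 ^ CARD('d) * N * m')"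
      by (simp add: S_def power2_eq_square mult_ac)
    then have "N \<le> b" using N m' by (simp add: mult_le_cancel_right)
    then show ?thesis using real by (simp add: ennreal_leI)
  qed simp
qed

text \<open>
  The open boxes with a corner at the origin decrease to the empty set as their side length tends to 0.
\<close>

lemma small_box:
  fixes F :: "real ^ 'd \<Rightarrow> ennreal"
  assumes [measurable]: "F \<in> borel_measurable lebesgue" and fin: "(\<integral>\<^sup>+x. F x \<partial>lebesgue) < \<infinity>"
    and e: "0 < e"
  obtains l where "0 < l" "(\<integral>\<^sup>+x\<in>box 0 (\<chi> i. l). F x \<partial>lebesgue) < e"
proof -
  define A :: "nat \<Rightarrow> (real ^ 'd) set" where "A n = box 0 (\<chi> i. inverse (real (Suc n)))" for n
  have "decseq A"
    unfolding decseq_def A_def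
    by (force simp: mem_box_cart intro: less_le_trans le_imp_inverse_le)
  moreover have "(\<Inter>n. A n) = {}"
  proof (rule equals0I)
    fix x assume x: "x \<in> (\<Inter>n. A n)"
    then have "0 < x $ undefined" by (auto simp: A_def mem_box_cart)
    then obtain n where "inverse (real (Suc n)) < x $ undefined" using reals_Archimedean by blast
    moreover have "x \<in> A n" using x by auto
    then have "x $ undefined < inverse (real (Suc n))" unfolding A_def mem_box_cart by simp
    ultimately show False by linarith
  qed
  moreover have "emeasure (density lebesgue F) (A n) \<noteq> \<infinity>" for n
  proof -
    have "emeasure (density lebesgue F) (A n) \<le> (\<integral>\<^sup>+x. F x \<partial>lebesgue)"
      unfolding A_def by (subst emeasure_density) (auto intro!: nn_integral_mono simp: indicator_def)
    then show ?thesis using fin by auto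
  qed
  moreover have "range A \<subseteq> sets (density lebesgue F)" by (auto simp: A_def)
  ultimately have "(\<lambda>n. emeasure (density lebesgue F) (A n)) \<longlonglongrightarrow> emeasure (density lebesgue F) {}"
    using Lim_emeasure_decseq[of A "density lebesgue F"] by simp
  then have "eventually (\<lambda>n. emeasure (density lebesgue F) (A n) < e) sequentially"
    using e by (intro order_tendstoD) auto
  then obtain n where "emeasure (density lebesgue F) (A n) < e"
    using eventually_sequentially by auto
  then show thesis
    by (intro that[of "inverse (real (Suc n))"]) (auto simp: A_def emeasure_density)
qed

text \<open>
  Every height \<open>s\<close> between 0 and the height \<open>S\<close> of \<open>spike_lower_bound\<close> gives an admissible weight, and passing from
  height \<open>s\<close> to \<open>t\<close> changes the weight by a factor of at most \<open>1 + \<bar>t - s\<bar>\<close>. So the A1 constant \<open>\<kappa> s\<close> is Lipschitz on \<open>[0, S]\<close>,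
  and the intermediate value theorem finds a height at which it equals \<open>N\<close>. The box is chosen beforehand, so small
  that even the largest height adds at most the original integral.
\<close>

lemma A1_exact_constant:
  fixes v :: "real ^ 'd \<Rightarrow> real" and F :: "real ^ 'd \<Rightarrow> ennreal"
  assumes v: "weight v" and N: "A1_bound v (ennreal N)" "0 < N"
    and [measurable]: "F \<in> borel_measurable lebesgue"
    and fin: "(\<integral>\<^sup>+x. F x * ennreal (v x) \<partial>lebesgue) < \<infinity>"
  obtains u where "A1 u" "A1_const u = ennreal N" "AE x in lebesgue. v x \<le> u x"
    "(\<integral>\<^sup>+x. F x * ennreal (u x) \<partial>lebesgue) \<le> 2 * (\<integral>\<^sup>+x. F x * ennreal (v x) \<partial>lebesgue)"
proof -
  have [measurable]: "v \<in> borel_measurable lebesgue" and v0: "AE x in lebesgue. 0 < v x"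
    using v by (auto simp: weight_def)
  define S where "S = 4 ^ CARD('d) * N^2"
  have S: "0 < S" using N by (simp add: S_def)
  let ?J = "\<integral>\<^sup>+x. F x * ennreal (v x) \<partial>lebesgue"
  obtain l :: real where l: "0 < l"
    "ennreal S * (\<integral>\<^sup>+x\<in>box 0 (\<chi> i. l). F x * ennreal (v x) \<partial>lebesgue) \<le> ?J"
  proof (cases "?J = 0")
    case True
    have "(\<integral>\<^sup>+x\<in>box 0 (\<chi> i. 1). F x * ennreal (v x) \<partial>lebesgue) \<le> ?J"
      by (intro nn_integral_mono) (auto simp: indicator_def)
    then show ?thesis using True by (intro that[of 1]) auto
  next
    case False
    obtain l :: real where l: "0 < l"
      "(\<integral>\<^sup>+x\<in>box 0 (\<chi> i. l). F x * ennreal (v x) \<partial>lebesgue) < ?J / ennreal S"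
      using False fin S
      by (rule_tac small_box[of "\<lambda>x. F x * ennreal (v x)" "?J / ennreal S"])
        (auto simp: ennreal_zero_less_divide zero_less_iff_neq_zero)
    have "ennreal S * (\<integral>\<^sup>+x\<in>box 0 (\<chi> i. l). F x * ennreal (v x) \<partial>lebesgue) \<le> ?J"
      using divide_less_imp_mult_le[OF l(2)] by (simp add: mult.commute)
    with l(1) show ?thesis by (rule that)
  qed
  define Q :: "(real ^ 'd) set" where "Q = box 0 (\<chi> i. l)"
  have [measurable]: "Q \<in> sets lebesgue" by (simp add: Q_def)
  define u where "u s x = v x * (1 + s * indicator Q x)" for s x
  have u0: "u 0 = v" by (simp add: u_def fun_eq_iff)
  have [measurable]: "u s \<in> borel_measurable lebesgue" for s unfolding u_def[abs_def] by measurable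
  have up: "AE x in lebesgue. u t x \<le> (1 + (t - s)) * u s x" if "0 \<le> s" "s \<le> t" for s t
    using v0
  proof eventually_elim
    case (elim x)
    have "0 \<le> s * (t - s)" using that by simp
    then have "1 + t \<le> (1 + (t - s)) * (1 + s)" by (simp add: algebra_simps)
    then have "v x * (1 + t) \<le> v x * ((1 + (t - s)) * (1 + s))" using elim by (intro mult_left_mono) auto
    moreover have "v x \<le> (1 + (t - s)) * v x" using elim that mult_right_mono[of 1 "1 + (t - s)" "v x"] by simp
    ultimately show ?case by (auto simp: u_def indicator_def mult_ac)
  qed
  have down: "AE x in lebesgue. u s x \<le> 1 * u t x" if "0 \<le> s" "s \<le> t" for s t
    using v0 that by (auto elim!: eventually_mono simp: u_def indicator_def)
  have cmp: "A1_const (u t) \<le> ennreal (1 + (t - s)) * A1_const (u s)"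
    "A1_const (u s) \<le> ennreal (1 + (t - s)) * A1_const (u t)" if "0 \<le> s" "s \<le> t" for s t
    using A1_const_compare[OF _ _ up[OF that] down[OF that]] A1_const_compare[OF _ _ down[OF that] up[OF that]] that
    by auto
  have le0: "A1_const (u 0) \<le> ennreal N"
    using N unfolding u0 A1_const_def by (intro Inf_lower) auto
  have bd: "A1_const (u s) \<le> ennreal ((1 + s) * N)" if "0 \<le> s" for s
  proof -
    have "A1_const (u s) \<le> ennreal (1 + (s - 0)) * A1_const (u 0)" using that by (intro cmp) auto
    also have "\<dots> \<le> ennreal (1 + (s - 0)) * ennreal N" by (intro mult_left_mono le0) auto
    finally show ?thesis using that N by (simp add: ennreal_mult)
  qed
  define \<kappa> where "\<kappa> s = enn2real (A1_const (u s))" for s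
  have \<kappa>: "A1_const (u s) = ennreal (\<kappa> s)" if "0 \<le> s" for s
    using bd[OF that] unfolding \<kappa>_def by (metis ennreal_enn2real ennreal_less_top le_less_trans)
  have \<kappa>0: "0 \<le> \<kappa> s" for s by (simp add: \<kappa>_def)
  have \<kappa>_le: "\<kappa> s \<le> (1 + S) * N" if "0 \<le> s" "s \<le> S" for s
  proof -
    have "\<kappa> s \<le> (1 + s) * N" using bd[OF that(1)] \<kappa>[OF that(1)] that N by (simp add: ennreal_le_iff)
    also have "\<dots> \<le> (1 + S) * N" using that N by (intro mult_right_mono) auto
    finally show ?thesis .
  qed
  have lip: "\<bar>\<kappa> t - \<kappa> s\<bar> \<le> (1 + S) * N * (t - s)" if "0 \<le> s" "s \<le> t" "t \<le> S" for s t
  proof -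
    have "ennreal (\<kappa> t) \<le> ennreal ((1 + (t - s)) * \<kappa> s)" "ennreal (\<kappa> s) \<le> ennreal ((1 + (t - s)) * \<kappa> t)"
      using cmp[OF that(1,2)] that \<kappa> \<kappa>0 by (auto simp: ennreal_mult)
    then have "\<kappa> t \<le> (1 + (t - s)) * \<kappa> s" "\<kappa> s \<le> (1 + (t - s)) * \<kappa> t"
      using that \<kappa>0 by (simp_all add: ennreal_le_iff)
    then have "\<kappa> t - \<kappa> s \<le> (t - s) * \<kappa> s" "\<kappa> s - \<kappa> t \<le> (t - s) * \<kappa> t"
      by (simp_all add: algebra_simps)
    moreover have "(t - s) * \<kappa> s \<le> (t - s) * ((1 + S) * N)" "(t - s) * \<kappa> t \<le> (t - s) * ((1 + S) * N)"
      using that by (auto intro!: mult_left_mono \<kappa>_le)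
    ultimately have "\<bar>\<kappa> t - \<kappa> s\<bar> \<le> (t - s) * ((1 + S) * N)" by linarith
    then show ?thesis by (simp only: mult.commute)
  qed
  \<comment> \<open>\<open>(1 + S) N\<close> bounds \<open>\<kappa>\<close> on the whole interval and serves as the Lipschitz constant.\<close>
  have "((1 + S) * N)-lipschitz_on {0..S} \<kappa>"
  proof (rule lipschitz_onI)
    fix s t assume st: "s \<in> {0..S}" "t \<in> {0..S}"
    show "dist (\<kappa> s) (\<kappa> t) \<le> (1 + S) * N * dist s t"
      using lip[of s t] lip[of t s] st by (cases "s \<le> t") (auto simp: dist_real_def)
  qed (use N S in simp)
  then have cont: "continuous_on {0..S} \<kappa>" by (rule lipschitz_on_continuous_on)
  have "\<kappa> 0 \<le> N" using le0 \<kappa>[of 0] N by (simp add: ennreal_le_iff)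
  moreover have "N \<le> \<kappa> S"
  proof -
    have "ennreal N \<le> A1_const (u S)"
      unfolding A1_const_def u_def S_def Q_def
      by (intro Inf_greatest, elim CollectE, rule spike_lower_bound[OF v N l(1)])
    then show ?thesis using \<kappa>[of S] S \<kappa>0 by (simp add: ennreal_le_iff)
  qed
  ultimately obtain s where s: "0 \<le> s" "s \<le> S" "\<kappa> s = N"
    using IVT'[of \<kappa> 0 N S] cont S by auto
  show thesis
  proof (rule that[of "u s"])
    have wt: "weight (u s)" unfolding weight_def
    proof (intro conjI allI impI)
      show "AE x in lebesgue. 0 < u s x"
        using v0 s by (auto elim!: eventually_mono simp: u_def indicator_def)
      fix K :: "(real ^ 'd) set" assume K: "compact K"
      then have [measurable]: "K \<in> sets lebesgue" by (simp add: borel_compact)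
      have "set_integrable lebesgue K v" using v K by (simp add: weight_def)
      then have "integrable lebesgue (\<lambda>x. (1 + s) * (indicator K x *\<^sub>R v x))"
        unfolding set_integrable_def by (rule integrable_mult_right)
      then show "set_integrable lebesgue K (u s)"
        unfolding set_integrable_def
        by (rule Bochner_Integration.integrable_bound)
          (use v0 s in \<open>auto elim!: eventually_mono simp: u_def indicator_def abs_mult algebra_simps\<close>)
    qed measurable
    have "A1_bound (u s) (ennreal ((1 + (s - 0)) * 1) * ennreal N)"
      using s N up[of 0 s] down[of 0 s] unfolding u0 by (intro A1_bound_compare[of _ _ _ v]) auto
    then show "A1 (u s)" using wt unfolding A1_def
      by (auto intro!: exI[of _ "ennreal (1 + s) * ennreal N"] simp: ennreal_mult_less_top)
    show "A1_const (u s) = ennreal N" using \<kappa>[of s] s by simp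
    show "AE x in lebesgue. v x \<le> u s x" using down[of 0 s] s unfolding u0 by simp
    have "(\<integral>\<^sup>+x. F x * ennreal (u s x) \<partial>lebesgue)
       = (\<integral>\<^sup>+x. F x * ennreal (v x) + ennreal s * (F x * ennreal (v x) * indicator Q x) \<partial>lebesgue)"
    proof (intro nn_integral_cong_AE, use v0 in eventually_elim)
      fix x assume "0 < v x"
      then have "ennreal (u s x) = ennreal (v x) + ennreal s * ennreal (v x) * indicator Q x"
        using s by (auto simp: u_def indicator_def distrib_left ennreal_plus ennreal_mult mult_ac simp flip: ennreal_mult)
      then show "F x * ennreal (u s x) = F x * ennreal (v x) + ennreal s * (F x * ennreal (v x) * indicator Q x)"
        by (simp add: distrib_left mult_ac)
    qed
    also have "\<dots> = ?J + ennreal s * (\<integral>\<^sup>+x\<in>Q. F x * ennreal (v x) \<partial>lebesgue)"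
      by (subst nn_integral_add) (auto simp: nn_integral_cmult)
    also have "\<dots> \<le> ?J + ennreal S * (\<integral>\<^sup>+x\<in>Q. F x * ennreal (v x) \<partial>lebesgue)"
      using s by (intro add_left_mono mult_right_mono ennreal_leI) auto
    also have "\<dots> \<le> ?J + ?J" using l(2) unfolding Q_def by (intro add_left_mono)
    finally show "(\<integral>\<^sup>+x. F x * ennreal (u s x) \<partial>lebesgue) \<le> 2 * ?J" by (simp add: mult_2)
  qed
qed

lemma weak_opnormD:
  assumes C: "weak_opnorm p w T \<le> ennreal C" and f: "f \<in> Lp p w"
  shows "weak_Lp_norm p w (T f) \<le> ennreal C * Lp_norm p w f"
proof -
  let ?A = "{C. \<forall>f\<in>Lp p w. weak_Lp_norm p w (T f) \<le> C * Lp_norm p w f}"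
  have L: "Lp_norm p w f < \<infinity>" using f by (simp add: Lp_def)
  show ?thesis
  proof (cases "Lp_norm p w f = 0")
    case True
    have "?A \<noteq> {}"
    proof
      assume empty: "?A = {}"
      have "weak_opnorm p w T = top" unfolding weak_opnorm_def empty by simp
      then show False using C by (simp add: top_unique)
    qed
    then obtain C' where "C' \<in> ?A" by blast
    then have "weak_Lp_norm p w (T f) \<le> C' * Lp_norm p w f" using f by blast
    then show ?thesis using True by simp
  next
    case False
    have "weak_Lp_norm p w (T f) / Lp_norm p w f \<le> weak_opnorm p w T"
      unfolding weak_opnorm_def
    proof (rule Inf_greatest)
      fix C' assume "C' \<in> ?A"
      then have "weak_Lp_norm p w (T f) \<le> C' * Lp_norm p w f" using f by blast
      then have "weak_Lp_norm p w (T f) / Lp_norm p w f \<le> C' * Lp_norm p w f / Lp_norm p w f"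
        by (rule divide_right_mono_ennreal)
      then show "weak_Lp_norm p w (T f) / Lp_norm p w f \<le> C'"
        using False L by (simp add: ennreal_mult_divide_eq)
    qed
    then have "weak_Lp_norm p w (T f) / Lp_norm p w f \<le> ennreal C" using C by (rule order_trans)
    then have "weak_Lp_norm p w (T f) / Lp_norm p w f * Lp_norm p w f \<le> ennreal C * Lp_norm p w f"
      by (rule mult_right_mono) auto
    then show ?thesis using False L by (simp add: ennreal_divide_times less_top)
  qed
qed

lemma ennpowr_1 [simp]: "ennpowr a 1 = a"
  by (cases a) (auto simp: ennpowr_def)

lemma ennpowr_half_power2 [simp]: "(ennpowr a (1/2))^2 = a"
  by (cases a) (auto simp: ennpowr_def ennreal_power powr_half_sqrt ennreal_top_mult)

lemma ennreal_power2_le_imp_le: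
  fixes a b :: ennreal
  assumes "a^2 \<le> b^2"
  shows "a \<le> b"
proof (cases a; cases b)
  fix r s assume *: "0 \<le> r" "a = ennreal r" "0 \<le> s" "b = ennreal s"
  then have "r^2 \<le> s^2" using assms by (simp add: ennreal_power ennreal_le_iff)
  then have "r \<le> s" using \<open>0 \<le> s\<close> by (rule power2_le_imp_le)
  then show ?thesis unfolding *(2,4) by (rule ennreal_leI)
qed (use assms in \<open>auto simp: power2_eq_square ennreal_top_mult ennreal_mult_eq_top_iff top_unique\<close>)

section \<open>From A1 to A2\<close>

text \<open>
  The squared inequality avoids roots. With \<open>y = w(E)\<close>, \<open>X = \<parallel>f\<parallel>\<^sup>2\<close> and \<open>Z = \<integral> \<bar>f\<bar> v\<close>, the weak type (1,1) bound for the
  adjusted majorant reads \<open>t y \<le> 2 K Z\<close>, and Cauchy-Schwarz gives \<open>Z\<^sup>2 \<le> 4 X y\<close>. Dividing by \<open>y\<close> requires \<open>y\<close> to be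
  finite, which is why \<open>E\<close> is a bounded part of the superlevel set.
\<close>

lemma weak_type_core:
  fixes w :: "real ^ 'd \<Rightarrow> real" and T :: "(real ^ 'd \<Rightarrow> complex) \<Rightarrow> real ^ 'd \<Rightarrow> complex"
  assumes w: "A2 w" and f: "f \<in> Lp 2 w" and Tf: "T f \<in> borel_measurable lebesgue" and t: "0 < t"
    and E: "E \<in> sets lebesgue" "bounded E" "E \<subseteq> {x. t < norm (T f x)}"
    and N: "N = 8 * real CARD('d \<Rightarrow> bool) * 6 ^ CARD('d) * enn2real (A2_const w)"
    and T: "\<And>u. A1 u \<Longrightarrow> A1_const u = ennreal N \<Longrightarrow> weak_opnorm 1 u T \<le> ennreal K"
  shows "(ennreal t)^2 * emeasure (weighted w) E \<le> (4 * ennreal K * Lp_norm 2 w f)^2"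
proof -
  have [measurable]: "E \<in> sets lebesgue" by fact
  have W: "weight w" using w by (simp add: A2_def)
  then have [measurable]: "w \<in> borel_measurable lebesgue" and w0: "AE x in lebesgue. 0 < w x"
    by (auto simp: weight_def)
  have [measurable]: "f \<in> borel_measurable lebesgue" and f_fin: "Lp_norm 2 w f < \<infinity>"
    using f by (auto simp: Lp_def)
  define F where "F x = ennreal (norm (f x))" for x
  have [measurable]: "F \<in> borel_measurable lebesgue" unfolding F_def[abs_def] by measurable
  define G where "G = {x. t < norm (T f x)}"
  have [measurable]: "G \<in> sets lebesgue"
    using borel_measurable_less[of "\<lambda>x. t" lebesgue "\<lambda>x. norm (T f x)"] Tf by (simp add: G_def)
  define y where "y = emeasure (weighted w) E"
  have y: "y = (\<integral>\<^sup>+x\<in>E. ennreal (w x) \<partial>lebesgue)"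
    by (simp add: y_def weighted_def emeasure_density)
  have y_fin: "y < \<infinity>"
  proof -
    obtain I where I: "I \<in> cubes" "E \<subseteq> I" using bounded_subset_cube[OF E(2)] .
    have "y \<le> (\<integral>\<^sup>+x\<in>I. ennreal (w x) \<partial>lebesgue)"
      unfolding y using I(2) by (intro nn_integral_mono) (auto simp: indicator_def)
    then show ?thesis using weight_integral_finite[OF W I(1)] by (rule le_less_trans)
  qed
  have N_pos: "0 < N"
    using w A2_const_pos[OF w] unfolding N A2_def by (auto simp: enn2real_positive_iff)
  define X where "X = (\<integral>\<^sup>+x. (F x)^2 * ennreal (w x) \<partial>lebesgue)"
  have "(\<integral>\<^sup>+x. ennreal (norm (f x) powr 2) \<partial>weighted w) = X"
    unfolding weighted_def X_def
    by (subst nn_integral_density) (auto simp: F_def ennreal_power powr_numeral mult.commute)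
  then have X: "(Lp_norm 2 w f)^2 = X" by (simp add: Lp_norm_def)
  then have X_fin: "X < \<infinity>" using f_fin by (auto simp: power2_eq_square ennreal_mult_less_top)
  show ?thesis
  proof (cases "y = 0")
    case False
    obtain v where v: "weight v" "A1_bound v (ennreal N)" "AE x in lebesgue. x \<in> E \<longrightarrow> w x \<le> v x"
      "(\<integral>\<^sup>+x. (ennreal (v x))^2 * ennreal (inverse (w x)) \<partial>lebesgue) \<le> 4 * y"
      using A1_majorant[OF w E(1,2)] False unfolding y N by (auto simp: zero_less_iff_neq_zero)
    have [measurable]: "v \<in> borel_measurable lebesgue" using v(1) by (simp add: weight_def)
    define Z where "Z = (\<integral>\<^sup>+x. F x * ennreal (v x) \<partial>lebesgue)"
    have Z2: "Z^2 \<le> X * (4 * y)"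
    proof -
      \<comment> \<open>The factor \<open>1 = w^(1/2) w^(-1/2)\<close> splits the integrand between \<open>L\<^sup>2(w)\<close> and \<open>L\<^sup>2(1/w)\<close>.\<close>
      have "Z = (\<integral>\<^sup>+x. (F x * ennreal (sqrt (w x))) * (ennreal (v x) * ennreal (sqrt (inverse (w x)))) \<partial>lebesgue)"
        unfolding Z_def
      proof (intro nn_integral_cong_AE, use w0 in eventually_elim)
        fix x assume "0 < w x"
        then have "ennreal (sqrt (w x)) * ennreal (sqrt (inverse (w x))) = 1"
          by (simp add: real_sqrt_inverse flip: ennreal_mult)
        then have "F x * ennreal (v x) = F x * ennreal (v x) * (ennreal (sqrt (w x)) * ennreal (sqrt (inverse (w x))))"
          by simp
        also have "\<dots> = (F x * ennreal (sqrt (w x))) * (ennreal (v x) * ennreal (sqrt (inverse (w x))))"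
          by (simp only: mult_ac)
        finally show "F x * ennreal (v x) = (F x * ennreal (sqrt (w x))) * (ennreal (v x) * ennreal (sqrt (inverse (w x))))" .
      qed
      then have "Z^2 \<le> (\<integral>\<^sup>+x. (F x * ennreal (sqrt (w x)))^2 \<partial>lebesgue)
          * (\<integral>\<^sup>+x. (ennreal (v x) * ennreal (sqrt (inverse (w x))))^2 \<partial>lebesgue)"
        by (simp add: Cauchy_Schwarz_nn_integral)
      also have "(\<integral>\<^sup>+x. (F x * ennreal (sqrt (w x)))^2 \<partial>lebesgue) = X"
        unfolding X_def using w0
        by (intro nn_integral_cong_AE) (auto elim!: eventually_mono simp: power_mult_distrib ennreal_power)
      also have "(\<integral>\<^sup>+x. (ennreal (v x) * ennreal (sqrt (inverse (w x))))^2 \<partial>lebesgue)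
          = (\<integral>\<^sup>+x. (ennreal (v x))^2 * ennreal (inverse (w x)) \<partial>lebesgue)"
        using w0 by (intro nn_integral_cong_AE)
          (auto elim!: eventually_mono simp: power_mult_distrib ennreal_power[of "sqrt _"])
      also have "X * \<dots> \<le> X * (4 * y)" by (intro mult_left_mono v(4)) auto
      finally show ?thesis .
    qed
    also have "\<dots> < \<infinity>" using X_fin y_fin by (simp add: ennreal_mult_less_top)
    finally have Z_fin: "Z < \<infinity>" by (auto simp: power2_eq_square ennreal_mult_less_top)
    obtain u where u: "A1 u" "A1_const u = ennreal N" "AE x in lebesgue. v x \<le> u x"
      "(\<integral>\<^sup>+x. F x * ennreal (u x) \<partial>lebesgue) \<le> 2 * Z"
      using A1_exact_constant[OF v(1,2) N_pos, of F] Z_fin unfolding Z_def by auto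
    have [measurable]: "u \<in> borel_measurable lebesgue" using u(1) by (simp add: A1_def weight_def)
    have Lp1: "Lp_norm 1 u f = (\<integral>\<^sup>+x. F x * ennreal (u x) \<partial>lebesgue)"
      unfolding Lp_norm_def weighted_def
      by (subst nn_integral_density) (auto simp: F_def mult.commute)
    have "2 * Z < \<infinity>" using Z_fin by (simp add: ennreal_mult_less_top)
    then have "f \<in> Lp 1 u" using u(4) Lp1 by (auto simp: Lp_def intro: le_less_trans)
    then have "weak_Lp_norm 1 u (T f) \<le> ennreal K * Lp_norm 1 u f"
      using T[OF u(1,2)] by (intro weak_opnormD)
    also have "\<dots> \<le> ennreal K * (2 * Z)" unfolding Lp1 by (intro mult_left_mono u(4)) auto
    finally have weak: "weak_Lp_norm 1 u (T f) \<le> ennreal K * (2 * Z)" .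
    have "y \<le> (\<integral>\<^sup>+x\<in>G. ennreal (u x) \<partial>lebesgue)"
      unfolding y
    proof (intro nn_integral_mono_AE, use v(3) u(3) in eventually_elim)
      fix x assume "x \<in> E \<longrightarrow> w x \<le> v x" "v x \<le> u x"
      then show "ennreal (w x) * indicator E x \<le> ennreal (u x) * indicator G x"
        using E(3) by (auto simp: indicator_def G_def intro!: ennreal_leI)
    qed
    also have "\<dots> = emeasure (weighted u) G"
      by (simp add: weighted_def emeasure_density)
    finally have "ennreal t * y \<le> ennreal t * emeasure (weighted u) G" by (intro mult_left_mono) auto
    also have "\<dots> \<le> weak_Lp_norm 1 u (T f)"
      unfolding weak_Lp_norm_def G_def using t by (intro SUP_upper2[of t]) auto
    finally have "ennreal t * y \<le> ennreal K * (2 * Z)" using weak by (rule order_trans)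
    then have "(ennreal t * y)^2 \<le> (ennreal K * (2 * Z))^2" by (intro power_mono) auto
    also have "\<dots> = 4 * (ennreal K)^2 * Z^2" by (simp add: power_mult_distrib mult_ac)
    also have "\<dots> \<le> 4 * (ennreal K)^2 * (X * (4 * y))" by (intro mult_left_mono Z2) auto
    also have "\<dots> = y * ((4 * ennreal K)^2 * X)" by (simp add: power_mult_distrib mult_ac)
    also have "(ennreal t * y)^2 = y * ((ennreal t)^2 * y)" by (simp add: power2_eq_square mult_ac)
    finally have "(ennreal t)^2 * y \<le> (4 * ennreal K)^2 * X"
      using False y_fin by (simp add: ennreal_mult_le_mult_iff)
    then show ?thesis unfolding X[symmetric] y_def by (simp only: power_mult_distrib)
  qed (simp add: y_def)
qed

text \<open>
  The bounded parts of the superlevel set exhaust it, and the bound of \<open>weak_type_core\<close> is the same for all of them.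
\<close>

lemma weak_type_A2:
  fixes w :: "real ^ 'd \<Rightarrow> real" and T :: "(real ^ 'd \<Rightarrow> complex) \<Rightarrow> real ^ 'd \<Rightarrow> complex"
  assumes w: "A2 w" and meas: "\<And>f. f \<in> Lp 2 w \<Longrightarrow> T f \<in> borel_measurable lebesgue"
    and N: "N = 8 * real CARD('d \<Rightarrow> bool) * 6 ^ CARD('d) * enn2real (A2_const w)"
    and T: "\<And>u. A1 u \<Longrightarrow> A1_const u = ennreal N \<Longrightarrow> weak_opnorm 1 u T \<le> ennreal K"
  shows "weak_opnorm 2 w T \<le> 4 * ennreal K"
  unfolding weak_opnorm_def
proof (intro Inf_lower CollectI ballI)
  fix f assume f: "f \<in> Lp 2 w"
  show "weak_Lp_norm 2 w (T f) \<le> 4 * ennreal K * Lp_norm 2 w f"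
    unfolding weak_Lp_norm_def
  proof (rule SUP_least, rule ennreal_power2_le_imp_le)
    fix t :: real assume "t \<in> {0<..}"
    then have t: "0 < t" by simp
    define G where "G = {x. t < norm (T f x)}"
    have G: "G \<in> sets lebesgue"
      using borel_measurable_less[of "\<lambda>x. t" lebesgue "\<lambda>x. norm (T f x)"] meas[OF f] by (simp add: G_def)
    have "(\<lambda>n. emeasure (weighted w) (G \<inter> cball 0 (real n))) \<longlonglongrightarrow> emeasure (weighted w) (\<Union>n. G \<inter> cball 0 (real n))"
      using G by (intro Lim_emeasure_incseq) (auto simp: weighted_def incseq_def)
    moreover have "(\<Union>n. G \<inter> cball 0 (real n)) = G"
      by (auto intro: real_arch_simple)
    ultimately have "(\<lambda>n. (ennreal t)^2 * emeasure (weighted w) (G \<inter> cball 0 (real n)))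
        \<longlonglongrightarrow> (ennreal t)^2 * emeasure (weighted w) G"
      by (intro ennreal_tendsto_cmult) (simp_all add: power2_eq_square ennreal_mult_less_top)
    moreover have "(ennreal t)^2 * emeasure (weighted w) (G \<inter> cball 0 (real n)) \<le> (4 * ennreal K * Lp_norm 2 w f)^2" for n
      using G by (intro weak_type_core[OF w f meas[OF f] t _ _ _ N T]) (auto simp: G_def bounded_Int)
    ultimately have "(ennreal t)^2 * emeasure (weighted w) G \<le> (4 * ennreal K * Lp_norm 2 w f)^2"
      by (intro LIMSEQ_le_const2) auto
    then show "(ennreal t * ennpowr (emeasure (weighted w) {x. t < norm (T f x)}) (1 / 2))^2
        \<le> (4 * ennreal K * Lp_norm 2 w f)^2"
      unfolding power_mult_distrib[of "ennreal t"] ennpowr_half_power2 G_def .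
  qed
qed

theorem theorem2p2:
  shows "\<exists>c\<^sub>2::real. c\<^sub>2 \<ge> 1 \<and> (\<forall>c\<^sub>1::real. c\<^sub>1 > 0 \<longrightarrow> (\<exists>c\<^sub>1'::real. c\<^sub>1' > 0 \<and>
    (\<forall>(\<phi>::real \<Rightarrow> real) (T::(real ^ 'd \<Rightarrow> complex) \<Rightarrow> real ^ 'd \<Rightarrow> complex).
       (\<forall>t\<ge>1. \<phi> t \<ge> t) \<longrightarrow> admissible_operator T \<longrightarrow>
       (\<forall>w. A1 w \<longrightarrow> weak_opnorm 1 w T \<le> ennreal (c\<^sub>1 * \<phi> (enn2real (A1_const w)))) \<longrightarrow>
       (\<forall>w. A2 w \<longrightarrow> weak_opnorm 2 w T \<le> ennreal (c\<^sub>1' * \<phi> (c\<^sub>2 * enn2real (A2_const w)))))))"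
proof (rule exI[of _ "8 * real CARD('d \<Rightarrow> bool) * 6 ^ CARD('d)"], intro conjI allI impI)
  have "1 \<le> real CARD('d \<Rightarrow> bool)" by (simp add: Suc_le_eq)
  then have "1 \<le> 8 * real CARD('d \<Rightarrow> bool)" by linarith
  then have "1 * 1 \<le> (8 * real CARD('d \<Rightarrow> bool)) * 6 ^ CARD('d)" by (intro mult_mono) auto
  then show "1 \<le> 8 * real CARD('d \<Rightarrow> bool) * 6 ^ CARD('d)" by simp
next
  fix c\<^sub>1 :: real assume c1: "0 < c\<^sub>1"
  show "\<exists>c\<^sub>1'::real. c\<^sub>1' > 0 \<and>
    (\<forall>(\<phi>::real \<Rightarrow> real) (T::(real ^ 'd \<Rightarrow> complex) \<Rightarrow> real ^ 'd \<Rightarrow> complex).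
       (\<forall>t\<ge>1. \<phi> t \<ge> t) \<longrightarrow> admissible_operator T \<longrightarrow>
       (\<forall>w. A1 w \<longrightarrow> weak_opnorm 1 w T \<le> ennreal (c\<^sub>1 * \<phi> (enn2real (A1_const w)))) \<longrightarrow>
       (\<forall>w. A2 w \<longrightarrow> weak_opnorm 2 w T
          \<le> ennreal (c\<^sub>1' * \<phi> (8 * real CARD('d \<Rightarrow> bool) * 6 ^ CARD('d) * enn2real (A2_const w)))))"
  proof (rule exI[of _ "4 * c\<^sub>1"], intro conjI allI impI)
    show "0 < 4 * c\<^sub>1" using c1 by simp
    fix \<phi> :: "real \<Rightarrow> real" and T :: "(real ^ 'd \<Rightarrow> complex) \<Rightarrow> real ^ 'd \<Rightarrow> complex" and w :: "real ^ 'd \<Rightarrow> real"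
    assume adm: "admissible_operator T" and w: "A2 w"
      and T: "\<forall>w. A1 w \<longrightarrow> weak_opnorm 1 w T \<le> ennreal (c\<^sub>1 * \<phi> (enn2real (A1_const w)))"
    define N where "N = 8 * real CARD('d \<Rightarrow> bool) * 6 ^ CARD('d) * enn2real (A2_const w)"
    have "weak_opnorm 2 w T \<le> 4 * ennreal (c\<^sub>1 * \<phi> N)"
    proof (rule weak_type_A2[OF w _ N_def])
      show "T f \<in> borel_measurable lebesgue" if "f \<in> Lp 2 w" for f
        using adm w that by (auto simp: admissible_operator_def op_domain_def)
      fix u :: "real ^ 'd \<Rightarrow> real" assume u: "A1 u" "A1_const u = ennreal N"
      have "0 \<le> N" by (simp add: N_def)
      then show "weak_opnorm 1 u T \<le> ennreal (c\<^sub>1 * \<phi> N)" using T u by force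
    qed
    also have "\<dots> = ennreal (4 * c\<^sub>1 * \<phi> N)" by (simp add: ennreal_mult' mult.assoc)
    finally show "weak_opnorm 2 w T \<le> ennreal (4 * c\<^sub>1 * \<phi> N)" .
  qed
qed

end
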